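(* Let $p$ be a prime, $t\ge1$ an integer, and $m=p^t$. Define $d_m(n)$ by \[ \prod_{k=1}^\infty\frac{1-q^{mk}}{1-q^k}=\sum_{n=0}^\infty d_m(n)q^n . \] Then there are infinitely many non-nested arithmetic progressions $\{An+B: n\ge 0\}$ (with $A,B$ integers, $A\ge1$) such that $d_m(An+B)\equiv 0\pmod p$ for all $n\ge 0$.
   Context: $d_m(n)$ is the number of partitions of $n$ into parts not divisible by $m$. A family of arithmetic progressions is non-nested if no progression in the family is contained in another one of the family. *)

theory Defs
  imports
    "HOL-Analysis.Infinite_Products"
    "HOL-Computational_Algebra.Formal_Power_Series"
    "HOL-Number_Theory.Cong"
begin

unbundle no vec_syntax
unbundle fps_syntax

definition arith_prog :: "nat \<Rightarrow> nat \<Rightarrow> nat set" where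
  "arith_prog A B = range (\<lambda>n. A * n + B)"

definition non_nested :: "'a set set \<Rightarrow> bool" where
  "non_nested F \<longleftrightarrow> pairwise (\<lambda>S T. \<not> S \<subseteq> T) F"

(* The infinite product is taken in the X-adic topology on formal power series.
   The coefficient type is rat because the library's division of power series
   needs a field of coefficients; the index k starts at 0, so the factors
   are those for Suc k = 1, 2, 3, ... *)
definition is_d :: "nat \<Rightarrow> (nat \<Rightarrow> int) \<Rightarrow> bool" where
  "is_d m d \<longleftrightarrow>
     (\<lambda>k. (1 - fps_X ^ (m * Suc k)) / (1 - fps_X ^ Suc k) :: rat fps)
       has_prod Abs_fps (\<lambda>n. of_int (d n))"

lemma factor_eq:
  assumes "m \<ge> 1"
  shows "(1 - fps_X ^ (m * Suc k)) / (1 - fps_X ^ Suc k :: rat fps)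
    = (\<Sum>j<m. fps_X ^ (j * Suc k))"
proof -
  let ?y = "fps_X ^ Suc k :: rat fps"
  have nz: "1 - ?y \<noteq> 0"
  proof
    assume "1 - ?y = 0"
    hence "(1 - ?y) $ 0 = 0" by simp
    thus False by (simp del: power_Suc add: fps_X_power_nth)
  qed
  have "1 - fps_X ^ (m * Suc k) = (1 - ?y) * (\<Sum>j<m. ?y ^ j)"
    by (metis mult.commute one_diff_power_eq power_mult)
  also have "(\<Sum>j<m. ?y ^ j) = (\<Sum>j<m. fps_X ^ (j * Suc k))"
    by (metis mult.commute power_mult)
  finally show ?thesis using nz by (metis nonzero_mult_div_cancel_left)
qed

lemma factor_nth:
  assumes "m \<ge> 1" "i \<le> k"
  shows "(\<Sum>j<m. fps_X ^ (j * Suc k) :: rat fps) $ i = (if i = 0 then 1 else 0)"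
proof -
  have "(\<Sum>j<m. fps_X ^ (j * Suc k) :: rat fps) $ i
      = (\<Sum>j<m. if j = 0 then (if i = 0 then 1 else 0) else 0)"
    unfolding fps_sum_nth
  proof (rule sum.cong)
    fix j assume "j \<in> {..<m}"
    show "(fps_X ^ (j * Suc k) :: rat fps) $ i = (if j = 0 then (if i = 0 then 1 else 0) else 0)"
    proof (cases j)
      case (Suc l)
      hence "i < j * Suc k" using assms(2) by simp
      thus ?thesis using Suc by (simp del: mult_Suc_right mult_Suc add: fps_X_power_nth)
    qed simp
  qed simp
  thus ?thesis using assms(1) by (simp add: sum.delta)
qed

lemma is_d_exists:
  assumes "m \<ge> 1"
  shows "\<exists>d. is_d m d"
proof -
  define g where "g k = (\<Sum>j<m. fps_X ^ (j * Suc k) :: rat fps)" for k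
  define P where "P n = (\<Prod>i\<le>n. g i)" for n
  have g_nth: "g k $ i = (if i = 0 then 1 else 0)" if "i \<le> k" for k i
    unfolding g_def by (rule factor_nth[OF assms that])
  have step: "P (Suc n) $ i = P n $ i" if "i \<le> n" for n i
  proof -
    have "P (Suc n) $ i = (\<Sum>l=0..i. P n $ l * g (Suc n) $ (i - l))"
      by (simp add: P_def fps_mult_nth)
    also have "\<dots> = (\<Sum>l=0..i. if l = i then P n $ i else 0)"
      by (rule sum.cong) (use that in \<open>auto simp: g_nth\<close>)
    finally show ?thesis by simp
  qed
  have stab: "P n $ i = P i $ i" if "i \<le> n" for n i
    using that by (induction n rule: dec_induct) (auto simp: step)
  have g_Ints: "g k $ i \<in> \<int>" for k i
    unfolding g_def fps_sum_nth by (intro Ints_sum) (auto simp: fps_X_power_nth)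
  have P_Ints: "P n $ i \<in> \<int>" for n i
  proof (induction n arbitrary: i)
    case 0
    show ?case using g_Ints by (simp add: P_def)
  next
    case (Suc n)
    have "P (Suc n) $ i = (\<Sum>l=0..i. P n $ l * g (Suc n) $ (i - l))"
      by (simp add: P_def fps_mult_nth)
    thus ?case using Suc g_Ints by (auto intro!: Ints_sum Ints_mult)
  qed
  define d where "d i = \<lfloor>P i $ i\<rfloor>" for i
  have d: "of_int (d i) = P i $ i" for i
    using P_Ints[of i i] by (auto simp: d_def elim: Ints_cases)
  let ?L = "Abs_fps (\<lambda>n. of_int (d n)) :: rat fps"
  have "P \<longlonglongrightarrow> ?L"
  proof (rule tendsto_fpsI)
    fix i
    have "P n $ i = ?L $ i" if "n \<ge> i" for n
      using stab[OF that] by (simp add: d)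
    thus "\<forall>\<^sub>F n in sequentially. P n $ i = ?L $ i"
      unfolding eventually_sequentially by blast
  qed
  moreover have "?L \<noteq> 0"
  proof
    assume "?L = 0"
    hence "?L $ 0 = 0" by simp
    hence "P 0 $ 0 = 0" by (simp add: d)
    thus False by (simp add: P_def g_nth)
  qed
  ultimately have "g has_prod ?L"
    by (simp add: has_prod_def raw_has_prod_def P_def[abs_def])
  thus ?thesis
    unfolding is_d_def factor_eq[OF assms] g_def by blast
qed

lemma is_d_unique: "is_d m d \<Longrightarrow> is_d m d' \<Longrightarrow> d = d'"
  by (auto simp: is_d_def fps_eq_iff fun_eq_iff dest: has_prod_unique2)

definition d_coeff :: "nat \<Rightarrow> nat \<Rightarrow> int" where
  "d_coeff m = (THE d. is_d m d)"

theorem d_coeff_generating_function: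
  assumes "m \<ge> 1"
  shows "(\<lambda>k. (1 - fps_X ^ (m * Suc k)) / (1 - fps_X ^ Suc k) :: rat fps)
           has_prod Abs_fps (\<lambda>n. of_int (d_coeff m n))"
proof -
  have "\<exists>!d. is_d m d" using is_d_exists[OF assms] is_d_unique by blast
  from theI'[OF this] show ?thesis by (simp add: d_coeff_def is_d_def)
qed

end

theory Submission
  imports Defs "HOL-Computational_Algebra.Formal_Laurent_Series"
begin

unbundle fps_syntax

text \<open>Write \<open>E(q) = \<Prod>(1 - q^k)\<close> and \<open>r = m - 1\<close>. Modulo \<open>p\<close> the generating function \<open>E(q^m) / E(q)\<close> is
  congruent to \<open>E(q)^r\<close>, so the coefficients in question are those of \<open>\<eta>^r\<close>, where
  \<open>\<eta> = X E(X^24)\<close>. Let \<open>U\<close> keep the coefficients with index divisible by 5, let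
  \<open>\<eta>\<^sub>5 = \<eta>(X^5)\<close>, \<open>\<eta>\<^sub>2\<^sub>5 = \<eta>(X^25)\<close>, \<open>Y = \<eta> / \<eta>\<^sub>2\<^sub>5\<close> and \<open>\<tau> = (\<eta> / \<eta>\<^sub>5)^6\<close>. Watson's quintic
  \<open>Y^5 + 5 Y^4 + 15 Y^3 + 25 Y^2 + 25 Y = \<tau>(X^5)\<close> shows that \<open>U\<close> maps the lattice spanned by the quotients
  \<open>e\<^sub>n = \<eta>^n \<eta>\<^sub>5^(r - n)\<close> with \<open>- r / 4 < n < 5 r / 4\<close> into itself. If \<open>p \<noteq> 5\<close>, then \<open>U\<close> is injective
  on this lattice modulo \<open>p\<close>, hence a permutation of a finite set, and some \<open>U^(N + 1)\<close> fixes
  \<open>e\<^sub>0 = \<eta>\<^sub>5^r\<close> modulo \<open>p\<close>. As \<open>U e\<^sub>0 = \<eta>^r\<close>, it follows that \<open>U^N \<eta>^r\<close> is congruent to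
  \<open>\<eta>\<^sub>5^r\<close>, which has no terms with exponent prime to 5. If \<open>p = 5\<close>, then already \<open>U (\<eta>^r)\<close> vanishes
  modulo 5, because \<open>U (Y^4) = - 5\<close>. Finally, one progression contains infinitely many pairwise disjoint
  ones.\<close>

subsection \<open>The pentagonal number theorem\<close>

text \<open>The series \<open>theta\<close> is \<open>\<eta>(24 z)\<close> with its expansion \<open>\<Sum> chi(s) X^(s^2)\<close> as definition; the factors
  beyond the \<open>n\<close>-th do not affect the \<open>n\<close>-th coefficient of \<open>euler\<close>.\<close>

definition chi :: "int \<Rightarrow> int" where
  "chi x = (if x mod 12 \<in> {1, 11} then 1 else if x mod 12 \<in> {5, 7} then - 1 else 0)"

definition theta :: "int fps" where
  "theta = Abs_fps (\<lambda>n. \<Sum>s | s ^ 2 = n. chi (int s))"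

definition euler :: "int fps" where
  "euler = Abs_fps (\<lambda>n. (\<Prod>k=1..n. 1 - fps_X ^ k) $ n)"

section \<open>Congruences modulo powers of X\<close>

lemma fps_X_power_dvd_iff:
  fixes f :: "'a :: comm_ring_1 fps"
  shows "fps_X ^ L dvd f \<longleftrightarrow> (\<forall>i<L. f $ i = 0)"
proof
  assume "\<forall>i<L. f $ i = 0"
  hence "f = fps_X ^ L * fps_shift L f"
    by (intro fps_ext) (auto simp: fps_X_power_mult_nth)
  thus "fps_X ^ L dvd f" by (rule dvdI)
qed (auto simp: fps_X_power_mult_nth)

lemma euler_prod_stable:
  assumes "i \<le> n"
  shows "(\<Prod>k=1..n. 1 - fps_X ^ k :: int fps) $ i = euler $ i"
  using assms
proof (induction n rule: dec_induct)
  case (step n)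
  have "(\<Prod>k=1..Suc n. 1 - fps_X ^ k :: int fps) = (\<Prod>k=1..n. 1 - fps_X ^ k) - fps_X ^ Suc n * (\<Prod>k=1..n. 1 - fps_X ^ k)"
    by (simp add: algebra_simps del: power_Suc)
  thus ?case using step by (simp add: fps_X_power_mult_nth del: power_Suc)
qed (simp add: euler_def)

lemma euler_nth_0 [simp]: "euler $ 0 = 1"
  by (simp add: euler_def)

text \<open>Identities for \<open>euler\<close> are checked modulo every power of
  \<open>fps_X\<close>, where a truncated product can replace the infinite one.\<close>

lemma euler_cong:
  "fps_X ^ Suc n dvd (euler - (\<Prod>k=1..n. 1 - fps_X ^ k))"
  unfolding fps_X_power_dvd_iff by (auto simp: euler_prod_stable[unfolded One_nat_def] less_Suc_eq_le)

text \<open>Shanks' finite form of Euler's identity: \<open>T s\<close> is a triangular number, and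
  the exponents on the right are the pentagonal numbers k (3 k - 1) / 2 and k (3 k + 1) / 2 with k =
  j + 1. In the induction on \<open>n\<close> the change of the left side telescopes.\<close>

lemma shanks_pentagonal_finite:
  fixes x :: "'a :: comm_ring_1"
  defines "T \<equiv> \<lambda>s::nat. \<Sum>i\<le>s. i"
  shows "(\<Sum>s\<le>n. (- 1) ^ s * (\<Prod>k=Suc s..n. 1 - x ^ k) * x ^ (s * n + T s)) =
         1 + (\<Sum>j<n. (- 1) ^ Suc j * (x ^ ((Suc j) ^ 2 + T j) + x ^ ((Suc j) ^ 2 + T (Suc j))))"
proof (induction n)
  case 0
  show ?case by (simp add: T_def)
next
  case (Suc n)
  define Q where "Q s = (\<Prod>k=Suc s..n. 1 - x ^ k)" for s
  \<comment> \<open>The change of the \<open>s\<close>-th term splits into a multiple of 1 - x^s and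
    \<open>- h s\<close>.\<close>
  define h where "h s = (- 1) ^ s * Q s * x ^ (Suc s * Suc n + T s)" for s
  have T: "T (Suc s) = T s + Suc s" for s
    by (simp add: T_def)
  have Q: "(1 - x ^ Suc s) * Q (Suc s) = Q s" if "s < n" for s
    unfolding Q_def by (rule prod.atLeast_Suc_atMost[symmetric]) (use that in simp)
  have "(\<Sum>s\<le>n. (- 1) ^ s * (\<Prod>k=Suc s..Suc n. 1 - x ^ k) * x ^ (s * Suc n + T s))
      - (\<Sum>s\<le>n. (- 1) ^ s * Q s * x ^ (s * n + T s))
      = (\<Sum>s\<le>n. - ((- 1) ^ s) * (1 - x ^ s) * Q s * x ^ (s * n + T s) - h s)"
    unfolding sum_subtractf[symmetric]
  proof (rule sum.cong)
    fix s assume "s \<in> {..n}"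
    hence *: "(\<Prod>k=Suc s..Suc n. 1 - x ^ k) = Q s * (1 - x ^ Suc n)"
      by (simp add: Q_def mult.commute)
    show "(- 1) ^ s * (\<Prod>k=Suc s..Suc n. 1 - x ^ k) * x ^ (s * Suc n + T s) -
        (- 1) ^ s * Q s * x ^ (s * n + T s) =
        - ((- 1) ^ s) * (1 - x ^ s) * Q s * x ^ (s * n + T s) - h s"
      unfolding * by (simp add: h_def algebra_simps power_add)
  qed simp
  also have "\<dots> = (\<Sum>s\<le>n. - ((- 1) ^ s) * (1 - x ^ s) * Q s * x ^ (s * n + T s)) - (\<Sum>s\<le>n. h s)"
    by (rule sum_subtractf)
  \<comment> \<open>The term s = 0 vanishes; in the others 1 - x^s is absorbed into
    \<open>Q\<close>, which turns the term s + 1 into \<open>h s\<close>.\<close>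
  also have "(\<Sum>s\<le>n. - ((- 1) ^ s) * (1 - x ^ s) * Q s * x ^ (s * n + T s)) = (\<Sum>s<n. h s)"
  proof -
    have "(\<Sum>s\<le>n. - ((- 1) ^ s) * (1 - x ^ s) * Q s * x ^ (s * n + T s))
        = (\<Sum>s<n. - ((- 1) ^ Suc s) * ((1 - x ^ Suc s) * Q (Suc s)) * x ^ (Suc s * n + T (Suc s)))"
      unfolding lessThan_Suc_atMost[symmetric] sum.lessThan_Suc_shift by (simp add: mult_ac)
    also have "\<dots> = (\<Sum>s<n. h s)"
      by (rule sum.cong) (simp_all only: Q lessThan_iff h_def T, simp_all add: algebra_simps power_add)
    finally show ?thesis .
  qed
  also have "(\<Sum>s<n. h s) - (\<Sum>s\<le>n. h s) = - h n"
    by (simp add: lessThan_Suc_atMost[symmetric])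
  also have "- h n = (- 1) ^ Suc n * x ^ ((Suc n) ^ 2 + T n)"
    by (simp add: h_def Q_def power2_eq_square)
  finally have *: "(\<Sum>s\<le>n. (- 1) ^ s * (\<Prod>k=Suc s..Suc n. 1 - x ^ k) * x ^ (s * Suc n + T s))
      = (\<Sum>s\<le>n. (- 1) ^ s * Q s * x ^ (s * n + T s)) + (- 1) ^ Suc n * x ^ ((Suc n) ^ 2 + T n)"
    by (simp add: algebra_simps)
  have "(\<Sum>s\<le>Suc n. (- 1) ^ s * (\<Prod>k=Suc s..Suc n. 1 - x ^ k) * x ^ (s * Suc n + T s))
      = (\<Sum>s\<le>n. (- 1) ^ s * (\<Prod>k=Suc s..Suc n. 1 - x ^ k) * x ^ (s * Suc n + T s))
        + (- 1) ^ Suc n * x ^ ((Suc n) ^ 2 + T (Suc n))"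
    by (simp add: power2_eq_square)
  thus ?case unfolding * Suc.IH[folded Q_def] by (simp add: algebra_simps)
qed

lemma chi_eq_0:
  assumes "even x \<or> 3 dvd x"
  shows "chi x = 0"
proof -
  have "x mod 12 \<noteq> 1" "x mod 12 \<noteq> 11" "x mod 12 \<noteq> 5" "x mod 12 \<noteq> 7"
    using assms by presburger+
  thus ?thesis by (simp add: chi_def)
qed

text \<open>After s = 1, each block of six consecutive integers contains two that are prime to 6,
  and \<open>chi\<close> has the same sign on both. This is the pairing of terms in
  \<open>shanks_pentagonal_finite\<close>.\<close>

lemma chi_block:
  fixes g :: "nat \<Rightarrow> int"
  shows "(\<Sum>s<6 * n + 2. chi (int s) * g s)
     = g 1 + (\<Sum>j<n. (- 1) ^ Suc j * (g (6 * j + 5) + g (6 * j + 7)))"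
proof (induction n)
  case 0
  show ?case by (simp add: numeral_2_eq_2 chi_def)
next
  case (Suc n)
  have "chi (int (6*n+2)) = 0" "chi (int (6*n+3)) = 0" "chi (int (6*n+4)) = 0" "chi (int (6*n+6)) = 0"
    by (rule chi_eq_0, presburger)+
  moreover have "chi (int (6*n+5)) = (- 1) ^ Suc n \<and> chi (int (6*n+7)) = (- 1) ^ Suc n"
  proof (cases "even n")
    case True
    then obtain k where "n = 2 * k" by auto
    hence "int (6*n+5) mod 12 = 5" "int (6*n+7) mod 12 = 7" by presburger+
    thus ?thesis using True by (simp add: chi_def)
  next
    case False
    then obtain k where "n = 2 * k + 1" by (auto elim: oddE)
    hence "int (6*n+5) mod 12 = 11" "int (6*n+7) mod 12 = 1" by presburger+
    thus ?thesis using False by (simp add: chi_def)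
  qed
  moreover have "(\<Sum>s<6 * Suc n + 2. chi (int s) * g s) = (\<Sum>s<6 * n + 2. chi (int s) * g s)
      + chi (int (6*n+2)) * g (6*n+2) + chi (int (6*n+3)) * g (6*n+3) + chi (int (6*n+4)) * g (6*n+4)
      + chi (int (6*n+5)) * g (6*n+5) + chi (int (6*n+6)) * g (6*n+6) + chi (int (6*n+7)) * g (6*n+7)"
  proof -
    have "6 * Suc n + 2 = Suc (Suc (Suc (Suc (Suc (Suc (6 * n + 2))))))" by simp
    thus ?thesis by (simp only: sum.lessThan_Suc) (simp add: eval_nat_numeral)
  qed
  ultimately show ?case
    by (simp only: Suc.IH) (simp add: algebra_simps)
qed

text \<open>If N is k (3 k - 1) / 2 or k (3 k + 1) / 2, then 24 N + 1 is (6 k - 1)^2 or (6 k + 1)^2;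
  so pentagonal exponents become squares and the signs become values of \<open>chi\<close>.\<close>

theorem pentagonal: "euler $ n = theta $ (24 * n + 1)"
proof -
  define T where "T s = (\<Sum>i\<le>s. i)" for s :: nat
  have T: "2 * T s = s * (s + 1)" for s
    unfolding T_def by (induction s) auto
  let ?X = "fps_X :: int fps"
  define S where "S = (\<Sum>s\<le>n. (- 1) ^ s * (\<Prod>k=Suc s..n. 1 - ?X ^ k) * ?X ^ (s * n + T s))"
  \<comment> \<open>A term with s > 0 has order at least s n + T s > n, so only the bare product is
    left.\<close>
  have "S $ n = (\<Prod>k=1..n. 1 - ?X ^ k) $ n"
  proof -
    have "S $ n = (\<Sum>s\<le>n. ((- 1) ^ s * (\<Prod>k=Suc s..n. 1 - ?X ^ k) * ?X ^ (s * n + T s)) $ n)"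
      by (simp add: S_def fps_sum_nth)
    also have "\<dots> = (\<Sum>s\<le>n. if s = 0 then (\<Prod>k=1..n. 1 - ?X ^ k) $ n else 0)"
    proof (rule sum.cong)
      fix s assume "s \<in> {..n}"
      show "((- 1) ^ s * (\<Prod>k=Suc s..n. 1 - ?X ^ k) * ?X ^ (s * n + T s)) $ n
        = (if s = 0 then (\<Prod>k=1..n. 1 - ?X ^ k) $ n else 0)"
      proof (cases "s = 0")
        case True
        thus ?thesis by (simp add: T_def)
      next
        case False
        hence "T s > 0" using T[of s] by (cases "T s") auto
        moreover have "s * n \<ge> n" using False by simp
        ultimately have "s * n + T s > n" by linarith
        thus ?thesis using False by (simp add: fps_X_power_mult_right_nth)
      qed
    qed simp
    also have "\<dots> = (\<Prod>k=1..n. 1 - ?X ^ k) $ n"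
      by (simp add: sum.delta)
    finally show ?thesis .
  qed
  hence "euler $ n = S $ n" by (simp add: euler_def)
  also define g where "g s = (if s ^ 2 = 24 * n + 1 then 1 else 0 :: int)" for s :: nat
  have "S $ n = g 1 + (\<Sum>j<n. (- 1) ^ Suc j * (g (6 * j + 5) + g (6 * j + 7)))"
  proof -
    have e: "(n = (Suc j) ^ 2 + T j) = ((6 * j + 5) ^ 2 = 24 * n + 1)"
        "(n = (Suc j) ^ 2 + T (Suc j)) = ((6 * j + 7) ^ 2 = 24 * n + 1)" for j
    proof -
      have "(6 * j + 5) ^ 2 = 24 * ((Suc j) ^ 2 + T j) + 1"
        using T[of j] by (simp add: power2_eq_square algebra_simps)
      thus "(n = (Suc j) ^ 2 + T j) = ((6 * j + 5) ^ 2 = 24 * n + 1)" by auto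
      have "(6 * j + 7) ^ 2 = 24 * ((Suc j) ^ 2 + T (Suc j)) + 1"
        using T[of "Suc j"] by (simp add: power2_eq_square algebra_simps)
      thus "(n = (Suc j) ^ 2 + T (Suc j)) = ((6 * j + 7) ^ 2 = 24 * n + 1)" by auto
    qed
    have c: "((- 1) ^ Suc j * f) $ n = (- 1) ^ Suc j * (f $ n)" for j and f :: "int fps"
      by (cases "even j") auto
    have "S = 1 + (\<Sum>j<n. (- 1) ^ Suc j * (?X ^ ((Suc j) ^ 2 + T j) + ?X ^ ((Suc j) ^ 2 + T (Suc j))))"
      unfolding S_def T_def by (rule shanks_pentagonal_finite)
    hence "S $ n = (1 :: int fps) $ n + (\<Sum>j<n. (- 1) ^ Suc j *
       ((?X ^ ((Suc j) ^ 2 + T j)) $ n + (?X ^ ((Suc j) ^ 2 + T (Suc j))) $ n))"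
      by (simp only: fps_add_nth fps_sum_nth c)
    thus ?thesis
      by (simp only: fps_X_power_nth e g_def) (simp add: fps_one_nth)
  qed
  also have "\<dots> = (\<Sum>s<6 * n + 2. chi (int s) * g s)"
    by (rule chi_block[symmetric])
  also have "\<dots> = (\<Sum>s | s ^ 2 = 24 * n + 1. chi (int s))"
  proof (rule sum.mono_neutral_cong_right)
    show "{s. s\<^sup>2 = 24 * n + 1} \<subseteq> {..<6 * n + 2}"
    proof safe
      fix s :: nat assume s: "s\<^sup>2 = 24 * n + 1"
      show "s < 6 * n + 2"
      proof (rule ccontr)
        assume "\<not> s < 6 * n + 2"
        hence "s ^ 2 \<ge> (6 * n + 2) ^ 2" by (intro power_mono) auto
        thus False using s by (simp add: power2_eq_square algebra_simps)
      qed
    qed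
  qed (auto simp: g_def)
  finally show ?thesis by (simp add: theta_def)
qed

text \<open>The square of an integer prime to 6 is 1 modulo 24, so \<open>theta\<close> lives on the
  exponents treated in \<open>pentagonal\<close>.\<close>

lemma theta_eq_euler: "theta = fps_X * (euler oo fps_X ^ 24)"
proof (rule fps_ext)
  fix N
  show "theta $ N = (fps_X * (euler oo fps_X ^ 24)) $ N"
  proof (cases "\<exists>n. N = 24 * n + 1")
    case True
    thus ?thesis by (auto simp: fps_nth_compose_X_power pentagonal)
  next
    case False
    have "chi (int s) = 0" if "s ^ 2 = N" for s
    proof (rule ccontr)
      assume "chi (int s) \<noteq> 0"
      hence "int s mod 12 \<in> {1, 5, 7, 11}" by (auto simp: chi_def split: if_splits)
      hence "s mod 12 = 1 \<or> s mod 12 = 5 \<or> s mod 12 = 7 \<or> s mod 12 = 11"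
        by (simp add: zmod_int[of s 12, simplified, symmetric])
      then obtain k j where "s = 12 * k + j" "j = 1 \<or> j = 5 \<or> j = 7 \<or> j = 11"
        by (metis mult_div_mod_eq)
      hence "s ^ 2 = j ^ 2 + 24 * (6 * k ^ 2 + k * j)" "j ^ 2 mod 24 = 1"
        by (auto simp: power2_eq_square algebra_simps)
      hence "N mod 24 = 1" using that by (simp only: mod_mult_self2)
      hence "N = 24 * (N div 24) + 1" by presburger
      thus False using False by blast
    qed
    hence "theta $ N = 0" by (simp add: theta_def)
    moreover have "(fps_X * (euler oo fps_X ^ 24)) $ N = 0"
    proof (cases N)
      case (Suc M)
      hence "\<not> 24 dvd M" using False by (auto elim!: dvdE)
      thus ?thesis using Suc by (simp add: fps_nth_compose_X_power)
    qed simp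
    ultimately show ?thesis by simp
  qed
qed

subsection \<open>The 5-dissection of the eta function\<close>

lemma chi_cong: "x mod 12 = y mod 12 \<Longrightarrow> chi x = chi y"
  by (simp add: chi_def)

lemma chi_minus [simp]: "chi (- x) = chi x"
proof -
  have "x mod 12 \<in> set [0..11]"
    by simp
  moreover have "chi (- x) = chi (- (x mod 12))" "chi x = chi (x mod 12)"
    by (rule chi_cong, simp add: mod_minus_eq)+
  moreover have "\<forall>a\<in>set [0..11]. chi (- a) = chi a" by code_simp
  ultimately show ?thesis by auto
qed

text \<open>The source of the minus sign in \<open>res_part_0_theta\<close>.\<close>

lemma chi_mult_5: "chi (5 * x) = - chi x"
proof -
  have "x mod 12 \<in> set [0..11]"
    by simp
  moreover have "chi (5 * x) = chi (5 * (x mod 12))" "chi x = chi (x mod 12)"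
    by (rule chi_cong, simp add: mod_mult_right_eq)+
  moreover have "\<forall>a\<in>set [0..11]. chi (5 * a) = - chi a" by code_simp
  ultimately show ?thesis by auto
qed

text \<open>The condition \<open>5 dvd x - 2 * y\<close> means \<open>x + i y = (2 + i) (u + i v)\<close>; the reflection is \<open>u \<mapsto> - u\<close>.
  Since it changes the sign of \<open>chi x * chi y\<close>, sums over this ideal of the Gaussian integers cancel.\<close>

lemma chi_reflect:
  assumes "5 * x' = - 3 * x - 4 * y" "5 * y' = - 4 * x + 3 * y"
  shows "chi x' * chi y' = - (chi x * chi y)"
proof -
  \<comment> \<open>5 is its own inverse modulo 12, so the assumptions determine x' and y' modulo
    12.\<close>
  have "x' = (9 * x + 4 * y) + 12 * (- 2 * x - 2 * y - 2 * x')"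
       "y' = (4 * x + 3 * y) + 12 * (- 2 * x + y - 2 * y')"
    using assms by presburger+
  hence "x' mod 12 = (9 * x + 4 * y) mod 12" "y' mod 12 = (4 * x + 3 * y) mod 12"
    by (metis mod_mult_self2)+
  hence "chi x' = chi (9 * (x mod 12) + 4 * (y mod 12))" "chi y' = chi (4 * (x mod 12) + 3 * (y mod 12))"
    by (auto intro!: chi_cong mod_add_cong mod_mult_cong)
  moreover have "chi x = chi (x mod 12)" "chi y = chi (y mod 12)"
    by (rule chi_cong, simp)+
  moreover have "x mod 12 \<in> set [0..11]" "y mod 12 \<in> set [0..11]" by auto
  moreover have "\<forall>a\<in>set [0..11]. \<forall>b\<in>set [0..11].
      chi (9 * a + 4 * b) * chi (4 * a + 3 * b) = - (chi a * chi b)" by code_simp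
  ultimately show ?thesis by auto
qed

text \<open>Both signs of a root are counted, hence the 2; the root 0 is harmless because
  \<open>chi 0 = 0\<close>. Sums over all integers are what the lattice symmetries act on.\<close>

lemma theta_nth_int: "2 * theta $ n = (\<Sum>x | x ^ 2 = int n. chi x)"
proof (cases "\<exists>s::nat. s ^ 2 = n")
  case True
  then obtain s where s: "n = s ^ 2" by auto
  have "{r. r ^ 2 = n} = {s}"
    unfolding s power2_eq_iff_nonneg[OF zero_le zero_le] by simp
  moreover have "{x. x ^ 2 = int n} = {int s, - int s}"
    unfolding s of_nat_power power2_eq_iff by blast
  moreover have "chi 0 = 0" by (rule chi_eq_0) simp
  ultimately show ?thesis by (cases "s = 0") (simp_all add: theta_def)
next
  case False
  have "x ^ 2 \<noteq> int n" for x :: int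
  proof
    assume "x ^ 2 = int n"
    hence "int ((nat \<bar>x\<bar>) ^ 2) = int n" by simp
    thus False using False by (simp only: of_nat_eq_iff) blast
  qed
  thus ?thesis using False by (simp add: theta_def)
qed

lemma abs_le_square_int: "\<bar>z :: int\<bar> \<le> z ^ 2"
proof (cases "z = 0")
  case False
  hence "\<bar>z\<bar> * 1 \<le> \<bar>z\<bar> * \<bar>z\<bar>" by (intro mult_left_mono) auto
  thus ?thesis by (simp add: power2_eq_square)
qed simp

lemma finite_sum_squares: "finite {(x::int, y::int). x ^ 2 + y ^ 2 = N \<and> P x y}"
proof (rule finite_subset)
  show "{(x::int, y::int). x ^ 2 + y ^ 2 = N \<and> P x y} \<subseteq> {-N..N} \<times> {-N..N}"
  proof (rule subsetI, unfold case_prod_unfold mem_Collect_eq)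
    fix p :: "int \<times> int" assume "fst p ^ 2 + snd p ^ 2 = N \<and> P (fst p) (snd p)"
    hence "\<bar>fst p\<bar> \<le> N" "\<bar>snd p\<bar> \<le> N"
      using abs_le_square_int[of "fst p"] abs_le_square_int[of "snd p"]
        zero_le_power2[of "fst p"] zero_le_power2[of "snd p"] by linarith+
    thus "p \<in> {-N..N} \<times> {-N..N}" by (simp add: mem_Times_iff abs_le_iff)
  qed
qed simp

definition res_part :: "nat \<Rightarrow> 'a::zero fps \<Rightarrow> 'a fps" where
  "res_part i f = Abs_fps (\<lambda>n. if n mod 5 = i then f $ n else 0)"

text \<open>Each factor contributes a 2 as in \<open>theta_nth_int\<close>; the Cauchy product then
  becomes a sum over representations by two squares.\<close>

lemma res_part_theta_mult:
  "4 * (res_part i theta * res_part j theta) $ N =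
   (\<Sum>(x, y) | x ^ 2 + y ^ 2 = int N \<and> x ^ 2 mod 5 = int i \<and> y ^ 2 mod 5 = int j. chi x * chi y)"
proof -
  have bound: "x \<in> {- int n..int n}" if "x ^ 2 = int n" for x n
    using abs_le_square_int[of x] that by auto
  define A where "A k n = {x::int. x ^ 2 = int n \<and> x ^ 2 mod 5 = int k}" for k n :: nat
  have fin: "finite (A k n)" for k n
    by (rule finite_subset[OF _ finite_atLeastAtMost_int[of "- int n" "int n"]]) (unfold A_def, use bound in blast)
  have 2: "2 * res_part k theta $ n = (\<Sum>x\<in>A k n. chi x)" for k n
  proof (cases "n mod 5 = k")
    case True
    hence "A k n = {x. x ^ 2 = int n}" by (auto simp: A_def zmod_int)
    thus ?thesis using True by (simp add: res_part_def theta_nth_int)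
  next
    case False
    hence "int n mod 5 \<noteq> int k" by (simp add: zmod_int[of n 5, simplified, symmetric])
    hence "A k n = {}" by (auto simp: A_def)
    thus ?thesis using False by (simp add: res_part_def)
  qed
  have "4 * (res_part i theta * res_part j theta) $ N
     = (\<Sum>n=0..N. (2 * res_part i theta $ n) * (2 * res_part j theta $ (N - n)))"
    by (simp add: fps_mult_nth sum_distrib_left algebra_simps)
  also have "\<dots> = (\<Sum>n=0..N. \<Sum>(x, y)\<in>A i n \<times> A j (N - n). chi x * chi y)"
    unfolding 2 sum_product by (simp add: sum.cartesian_product)
  also have "\<dots> = (\<Sum>(x, y)\<in>(\<Union>n\<in>{0..N}. A i n \<times> A j (N - n)). chi x * chi y)"
    by (rule sum.UNION_disjoint[symmetric]) (auto simp: fin, auto simp: A_def)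
  also have "(\<Union>n\<in>{0..N}. A i n \<times> A j (N - n)) =
     {(x, y). x ^ 2 + y ^ 2 = int N \<and> x ^ 2 mod 5 = int i \<and> y ^ 2 mod 5 = int j}"
  proof safe
    fix x y :: int assume *: "x ^ 2 + y ^ 2 = int N" "x ^ 2 mod 5 = int i" "y ^ 2 mod 5 = int j"
    have "nat (x ^ 2) \<le> N" using * zero_le_power2[of y] by linarith
    moreover have "x ^ 2 = int (nat (x ^ 2))" by simp
    moreover have "y ^ 2 = int (N - nat (x ^ 2))" using * zero_le_power2[of y] zero_le_power2[of x] by linarith
    ultimately show "(x, y) \<in> (\<Union>n\<in>{0..N}. A i n \<times> A j (N - n))"
      using * by (auto simp: A_def intro!: bexI[of _ "nat (x ^ 2)"])
  qed (auto simp: A_def)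
  finally show ?thesis .
qed

lemma sum_chi_lattice_eq_0:
  "(\<Sum>(x, y) | x ^ 2 + y ^ 2 = (N::int) \<and> 5 dvd x - 2 * y. chi x * chi y) = 0"
proof -
  let ?S = "{(x::int, y). x ^ 2 + y ^ 2 = N \<and> 5 dvd x - 2 * y}"
  \<comment> \<open>This is z = x + i y sent to - (3 + 4 i) / 5 times its conjugate, an involution
    that preserves the norm. Both divisions are exact on the lattice.\<close>
  define r where "r = (\<lambda>(x::int, y::int). ((- 3 * x - 4 * y) div 5, (- 4 * x + 3 * y) div 5))"
  have r: "5 * fst (r (x, y)) = - 3 * x - 4 * y" "5 * snd (r (x, y)) = - 4 * x + 3 * y"
    if "5 dvd x - 2 * y" for x y
  proof -
    from that obtain k where "x = 2 * y + 5 * k" by (auto simp: dvd_def algebra_simps)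
    hence "- 3 * x - 4 * y = 5 * (- 2 * y - 3 * k)" "- 4 * x + 3 * y = 5 * (- y - 4 * k)" by simp_all
    thus "5 * fst (r (x, y)) = - 3 * x - 4 * y" "5 * snd (r (x, y)) = - 4 * x + 3 * y"
      unfolding r_def by (simp_all del: right_diff_distrib_numeral)
  qed
  have rS: "r p \<in> ?S" "r (r p) = p" if "p \<in> ?S" for p
  proof -
    obtain x y where p: "p = (x, y)" by (cases p)
    obtain x' y' where r': "r (x, y) = (x', y')" by (cases "r (x, y)")
    have xy: "x ^ 2 + y ^ 2 = N" "5 dvd x - 2 * y" using that p by auto
    have *: "5 * x' = - 3 * x - 4 * y" "5 * y' = - 4 * x + 3 * y"
      using r[OF xy(2)] r' by auto
    have "25 * (x' ^ 2 + y' ^ 2) = (5 * x') ^ 2 + (5 * y') ^ 2"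
      by (simp add: power2_eq_square)
    also have "\<dots> = 25 * (x ^ 2 + y ^ 2)"
      unfolding * by (simp add: power2_eq_square algebra_simps)
    finally have "x' ^ 2 + y' ^ 2 = N" using xy by simp
    moreover have d: "5 dvd x' - 2 * y'" using * xy(2) by presburger
    ultimately show "r p \<in> ?S" by (simp add: p r')
    have "5 * fst (r (x', y')) = 5 * x" "5 * snd (r (x', y')) = 5 * y"
      using r[OF d] * by linarith+
    thus "r (r p) = p" by (simp add: p r' prod_eq_iff)
  qed
  have "(\<Sum>(x, y)\<in>?S. chi x * chi y) = (\<Sum>(x, y)\<in>?S. - (chi x * chi y))"
  proof (rule sum.reindex_bij_witness[of _ r r])
    fix p assume p: "p \<in> ?S"
    obtain x y where xy: "p = (x, y)" by (cases p)
    obtain x' y' where r': "r (x, y) = (x', y')" by (cases "r (x, y)")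
    have "chi x' * chi y' = - (chi x * chi y)"
      using r[of x y] p r' xy by (intro chi_reflect) auto
    thus "(case r p of (x, y) \<Rightarrow> - (chi x * chi y)) = (case p of (x, y) \<Rightarrow> chi x * chi y)"
      by (simp add: xy r')
  qed (use rS in auto)
  thus ?thesis by (simp add: sum_negf case_prod_unfold)
qed

lemma square_mod_5_cases: "(x::int) ^ 2 mod 5 \<in> {0, 1, 4}"
proof -
  have "x mod 5 \<in> set [0..4]" by auto
  moreover have "\<forall>a\<in>set [0..4::int]. a ^ 2 mod 5 \<in> {0, 1, 4}" by code_simp
  ultimately show ?thesis by (metis power_mod)
qed

lemma upto_0_4: "set [0..4::int] = {0, 1, 2, 3, 4}"
  by code_simp

text \<open>Modulo 5 the form x^2 + y^2 factors as (x - 2 y) (x + 2 y). Its zeros form two lines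
  that meet only at the origin, and elsewhere on them the squares are 1 and 4 in some order.\<close>

lemma dvd_5_lines:
  fixes x y :: int
  shows "5 dvd x - 2 * y \<and> 5 dvd x + 2 * y \<longleftrightarrow> x ^ 2 mod 5 = 0 \<and> y ^ 2 mod 5 = 0" (is ?A)
    and "5 dvd x - 2 * y \<or> 5 dvd x + 2 * y \<longleftrightarrow> x ^ 2 mod 5 = 0 \<and> y ^ 2 mod 5 = 0 \<or>
      x ^ 2 mod 5 = 1 \<and> y ^ 2 mod 5 = 4 \<or> x ^ 2 mod 5 = 4 \<and> y ^ 2 mod 5 = 1" (is ?B)
proof -
  define a b where "a = x mod 5" and "b = y mod 5"
  have ab: "a \<in> set [0..4]" "b \<in> set [0..4]" by (auto simp: a_def b_def)
  have "5 dvd x - 2 * y \<longleftrightarrow> (a - 2 * b) mod 5 = 0" "5 dvd x + 2 * y \<longleftrightarrow> (a + 2 * b) mod 5 = 0"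
    "x ^ 2 mod 5 = a ^ 2 mod 5" "y ^ 2 mod 5 = b ^ 2 mod 5"
    unfolding a_def b_def by presburger (presburger, simp_all add: power_mod)
  note eqs = this
  have "\<forall>a\<in>set [0..4::int]. \<forall>b\<in>set [0..4::int].
     ((a - 2 * b) mod 5 = 0 \<and> (a + 2 * b) mod 5 = 0 \<longleftrightarrow> a ^ 2 mod 5 = 0 \<and> b ^ 2 mod 5 = 0) \<and>
     ((a - 2 * b) mod 5 = 0 \<or> (a + 2 * b) mod 5 = 0 \<longleftrightarrow> a ^ 2 mod 5 = 0 \<and> b ^ 2 mod 5 = 0 \<or>
      a ^ 2 mod 5 = 1 \<and> b ^ 2 mod 5 = 4 \<or> a ^ 2 mod 5 = 4 \<and> b ^ 2 mod 5 = 1)"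
    unfolding upto_0_4 by simp
  from this[THEN bspec, OF ab(1), THEN bspec, OF ab(2)] show ?A ?B
    unfolding eqs by (rule conjunct1, rule conjunct2)
qed

text \<open>Inclusion-exclusion over the two prime ideals above 5 in the Gaussian integers: each
  carries total weight 0, their intersection is \<open>Z\<close> and their union is
  \<open>Z\<close>, \<open>T1\<close> and \<open>T2\<close> together. So the weights satisfy 2 Z +
  T1 + T2 = 0.\<close>

theorem theta_parts_mult: "res_part 1 theta * res_part 4 theta = - (res_part 0 theta ^ 2)"
proof (rule fps_ext)
  fix N
  define S where "S P = {(x::int, y::int). x ^ 2 + y ^ 2 = int N \<and> P x y}" for P
  define w where "w = (\<lambda>(x, y). chi x * chi y)"
  define L1 where "L1 = S (\<lambda>x y. 5 dvd x - 2 * y)"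
  define L2 where "L2 = S (\<lambda>x y. 5 dvd x + 2 * y)"
  define Z where "Z = S (\<lambda>x y. x ^ 2 mod 5 = 0 \<and> y ^ 2 mod 5 = 0)"
  define T1 where "T1 = S (\<lambda>x y. x ^ 2 mod 5 = 1 \<and> y ^ 2 mod 5 = 4)"
  define T2 where "T2 = S (\<lambda>x y. x ^ 2 mod 5 = 4 \<and> y ^ 2 mod 5 = 1)"
  have fin: "finite (S P)" for P
    unfolding S_def by (rule finite_sum_squares)
  note fins = fin[of "\<lambda>x y. 5 dvd x - 2 * y", folded L1_def] fin[of "\<lambda>x y. 5 dvd x + 2 * y", folded L2_def]
    fin[of "\<lambda>x y. x ^ 2 mod 5 = 0 \<and> y ^ 2 mod 5 = 0", folded Z_def]
    fin[of "\<lambda>x y. x ^ 2 mod 5 = 1 \<and> y ^ 2 mod 5 = 4", folded T1_def]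
    fin[of "\<lambda>x y. x ^ 2 mod 5 = 4 \<and> y ^ 2 mod 5 = 1", folded T2_def]
  have eqs: "4 * (res_part 0 theta * res_part 0 theta) $ N = sum w Z"
    "4 * (res_part 1 theta * res_part 4 theta) $ N = sum w T1"
    "4 * (res_part 4 theta * res_part 1 theta) $ N = sum w T2"
    unfolding res_part_theta_mult by (simp_all add: Z_def T1_def T2_def S_def w_def)
  have "sum w L1 = 0"
    using sum_chi_lattice_eq_0[of "int N"] by (simp add: L1_def S_def w_def)
  moreover have neg: "5 dvd - x - 2 * y \<longleftrightarrow> 5 dvd x + 2 * y" "5 dvd 2 * y - x \<longleftrightarrow> 5 dvd x - 2 * y"
    for x y :: int by presburger+
  \<comment> \<open>Changing the sign of x exchanges the two ideals, and \<open>chi\<close> is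
    even.\<close>
  have "sum w L2 = sum w L1"
    by (rule sum.reindex_bij_witness[of _ "\<lambda>(x, y). (- x, y)" "\<lambda>(x, y). (- x, y)"])
       (auto simp: L1_def L2_def S_def w_def neg)
  moreover have "sum w (L1 \<union> L2) + sum w (L1 \<inter> L2) = sum w L1 + sum w L2"
    by (rule sum.union_inter) (use fins in auto)
  moreover have "L1 \<inter> L2 = Z"
    by (auto simp: L1_def L2_def Z_def S_def dvd_5_lines(1)[symmetric])
  moreover have "L1 \<union> L2 = Z \<union> (T1 \<union> T2)"
  proof -
    have "L1 \<union> L2 = S (\<lambda>x y. 5 dvd x - 2 * y \<or> 5 dvd x + 2 * y)"
      by (auto simp: L1_def L2_def S_def)
    also have "\<dots> = Z \<union> (T1 \<union> T2)"
      unfolding dvd_5_lines(2) by (auto simp: Z_def T1_def T2_def S_def)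
    finally show ?thesis .
  qed
  moreover have "sum w (Z \<union> (T1 \<union> T2)) = sum w Z + (sum w T1 + sum w T2)"
    using fins by (subst sum.union_disjoint, simp, simp, force simp: Z_def T1_def T2_def S_def)
        (subst sum.union_disjoint, auto simp: T1_def T2_def S_def)
  ultimately have "2 * sum w Z + sum w T1 + sum w T2 = 0" by simp
  hence "8 * ((res_part 0 theta * res_part 0 theta) $ N + (res_part 1 theta * res_part 4 theta) $ N) = 0"
    unfolding eqs[symmetric] by (simp add: mult.commute[of "res_part 4 theta"])
  thus "(res_part 1 theta * res_part 4 theta) $ N = (- (res_part 0 theta ^ 2)) $ N"
    by (simp add: power2_eq_square)
qed

text \<open>A root of a square divisible by 5 is itself 5 s, and
  \<open>chi (5 * s) = - chi s\<close>.\<close>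

lemma res_part_0_theta: "res_part 0 theta = - (theta oo fps_X ^ 25)"
proof (rule fps_ext)
  fix n
  have sq5: "5 dvd s" if "5 dvd s ^ 2" for s :: nat
    using that by (simp add: prime_dvd_power_iff)
  have "(\<Sum>s | s ^ 2 = n. chi (int s)) = - (if 25 dvd n then theta $ (n div 25) else 0)" if n: "5 dvd n"
  proof (cases "25 dvd n")
    case True
    then obtain k where k: "n = 25 * k" by auto
    have "(\<Sum>s | s ^ 2 = n. chi (int s)) = (\<Sum>s\<in>(\<lambda>s. 5 * s) ` {s. s ^ 2 = k}. chi (int s))"
    proof (rule sum.cong)
      show "{s. s\<^sup>2 = n} = (*) 5 ` {s. s\<^sup>2 = k}"
      proof safe
        fix s assume "n = s ^ 2"
        moreover from this obtain r where "s = 5 * r" using sq5[of s] n by auto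
        ultimately show "s \<in> (*) 5 ` {s. s\<^sup>2 = k}" by (auto simp: k power_mult_distrib)
      qed (auto simp: k power_mult_distrib)
    qed simp
    also have "\<dots> = - (\<Sum>s | s ^ 2 = k. chi (int s))"
      by (subst sum.reindex) (auto simp: inj_on_def chi_mult_5 sum_negf)
    finally show ?thesis by (simp add: k theta_def)
  next
    case False
    have "s ^ 2 \<noteq> n" for s
    proof
      assume s: "s ^ 2 = n"
      then obtain r where "s = 5 * r" using sq5[of s] n by auto
      thus False using False s by (auto simp: power_mult_distrib)
    qed
    thus ?thesis using False by simp
  qed
  moreover have "\<not> 25 dvd n" if "\<not> 5 dvd n"
    using that by presburger
  ultimately show "res_part 0 theta $ n = (- (theta oo fps_X ^ 25)) $ n"
    by (auto simp: res_part_def fps_nth_compose_X_power theta_def dvd_eq_mod_eq_0)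
qed

theorem theta_dissection: "theta = res_part 1 theta + res_part 4 theta - (theta oo fps_X ^ 25)"
proof -
  have "theta $ n = 0" if "n mod 5 \<noteq> 0" "n mod 5 \<noteq> 1" "n mod 5 \<noteq> 4" for n
  proof -
    have "s ^ 2 \<noteq> n" for s
    proof
      assume "s ^ 2 = n"
      hence "(int s) ^ 2 mod 5 = int n mod 5" by (metis of_nat_power)
      moreover have "(int s) ^ 2 mod 5 \<in> {0, 1, 4}" by (rule square_mod_5_cases)
      ultimately show False using that by (auto; presburger)
    qed
    thus ?thesis by (simp add: theta_def)
  qed
  hence "theta = res_part 1 theta + res_part 4 theta + res_part 0 theta"
    by (intro fps_ext) (auto simp: res_part_def)
  thus ?thesis by (simp add: res_part_0_theta)
qed

subsection \<open>The norm of the eta function\<close>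

definition of_int_fps :: "int fps \<Rightarrow> 'a::ring_1 fps" where
  "of_int_fps f = Abs_fps (\<lambda>n. of_int (f $ n))"

lemma of_int_fps_nth [simp]: "of_int_fps f $ n = of_int (f $ n)"
  by (simp add: of_int_fps_def)

lemma of_int_fps_add: "of_int_fps (f + g) = of_int_fps f + of_int_fps g"
  by (rule fps_ext) simp

lemma of_int_fps_diff: "of_int_fps (f - g) = of_int_fps f - of_int_fps g"
  by (rule fps_ext) simp

lemma of_int_fps_uminus: "of_int_fps (- f) = - of_int_fps f"
  by (rule fps_ext) simp

lemma of_int_fps_mult: "of_int_fps (f * g) = of_int_fps f * of_int_fps g"
  by (rule fps_ext) (simp add: fps_mult_nth)

lemma of_int_fps_1 [simp]: "of_int_fps 1 = 1"
  by (rule fps_ext) simp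

lemma of_int_fps_X [simp]: "of_int_fps fps_X = fps_X"
  by (rule fps_ext) (simp add: fps_X_def)

lemma of_int_fps_power: "of_int_fps (f ^ n) = of_int_fps f ^ n"
  by (induction n) (simp_all add: of_int_fps_mult)

lemma of_int_fps_prod: "of_int_fps (\<Prod>i\<in>A. f i) = (\<Prod>i\<in>A. of_int_fps (f i))"
  by (induction A rule: infinite_finite_induct) (simp_all add: of_int_fps_mult)

lemma of_int_fps_compose_X_power: "of_int_fps (f oo fps_X ^ d) = of_int_fps f oo fps_X ^ d"
  by (rule fps_ext) (simp add: fps_nth_compose_X_power)

lemma of_int_fps_eq_iff: "(of_int_fps f :: 'a::ring_char_0 fps) = of_int_fps g \<longleftrightarrow> f = g"
  by (simp add: fps_eq_iff)

lemma dvd_diff_mult: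
  fixes d :: "'a::comm_ring_1"
  assumes "d dvd a - b" "d dvd a' - b'"
  shows "d dvd a * a' - b * b'"
proof -
  have "a * a' - b * b' = (a - b) * a' + b * (a' - b')" by (simp add: algebra_simps)
  thus ?thesis using assms by simp
qed

lemma dvd_diff_power:
  fixes d :: "'a::comm_ring_1"
  shows "d dvd a - b \<Longrightarrow> d dvd a ^ n - b ^ n"
  by (induction n) (auto intro: dvd_diff_mult)

lemma dvd_diff_prod:
  fixes d :: "'a::comm_ring_1"
  shows "(\<And>i. i \<in> A \<Longrightarrow> d dvd f i - g i) \<Longrightarrow> d dvd (\<Prod>i\<in>A. f i) - (\<Prod>i\<in>A. g i)"
  by (induction A rule: infinite_finite_induct) (auto intro: dvd_diff_mult)

lemma fps_eq_if_X_power_dvd: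
  fixes f g :: "'a::comm_ring_1 fps"
  assumes "\<And>n. fps_X ^ Suc n dvd f - g"
  shows "f = g"
proof (rule fps_ext)
  fix n
  show "f $ n = g $ n"
    using assms[of n] unfolding fps_X_power_dvd_iff by (auto dest: spec[of _ n])
qed

text \<open>The factors of w^j and w^(5 - j) are paired. This gives two quadratics in a - b with
  coefficients in the Gaussian periods \<open>G\<close> and \<open>H\<close>, the roots of x^2 + x -
  1.\<close>

lemma fifth_root_norm:
  fixes a b c w :: "'a::idom"
  assumes w: "1 + w + w ^ 2 + w ^ 3 + w ^ 4 = 0" and ab: "a * b = c ^ 2"
  shows "(a - b - c) * (w * a - w ^ 4 * b - c) * (w ^ 2 * a - w ^ 3 * b - c) *
         (w ^ 3 * a - w ^ 2 * b - c) * (w ^ 4 * a - w * b - c) = a ^ 5 - 11 * c ^ 5 - b ^ 5"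
proof -
  define G H where "G = w + w ^ 4" and "H = w ^ 2 + w ^ 3"
  define D where "D = a - b"
  have "G + H = (1 + w + w ^ 2 + w ^ 3 + w ^ 4) - 1"
    "G * H = (1 + w + w ^ 2 + w ^ 3 + w ^ 4) * (w ^ 3 - w + 1) - 1"
    unfolding G_def H_def by algebra+
  hence GH: "G + H = - 1" "G * H = - 1"
    unfolding w by simp_all
  have P1: "(w * a - w ^ 4 * b - c) * (w ^ 4 * a - w * b - c) = D ^ 2 + (3 - H) * c ^ 2 - G * c * D"
    unfolding D_def G_def H_def using w ab by algebra
  have P2: "(w ^ 2 * a - w ^ 3 * b - c) * (w ^ 3 * a - w ^ 2 * b - c) = D ^ 2 + (3 - G) * c ^ 2 - H * c * D"
    unfolding D_def G_def H_def using w ab by algebra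
  have "(a - b - c) * (w * a - w ^ 4 * b - c) * (w ^ 2 * a - w ^ 3 * b - c) *
         (w ^ 3 * a - w ^ 2 * b - c) * (w ^ 4 * a - w * b - c)
      = (D - c) * ((w * a - w ^ 4 * b - c) * (w ^ 4 * a - w * b - c)) *
        ((w ^ 2 * a - w ^ 3 * b - c) * (w ^ 3 * a - w ^ 2 * b - c))"
    by (simp only: D_def mult_ac)
  also have "\<dots> = (D - c) * (D ^ 2 + (3 - H) * c ^ 2 - G * c * D) * (D ^ 2 + (3 - G) * c ^ 2 - H * c * D)"
    unfolding P1 P2 ..
  also have "\<dots> = D ^ 5 + 5 * D ^ 3 * c ^ 2 + 5 * D * c ^ 4 - 11 * c ^ 5"
    using GH by algebra
  also have "\<dots> = a ^ 5 - 11 * c ^ 5 - b ^ 5"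
    unfolding D_def using ab by algebra
  finally show ?thesis .
qed

lemma fifth_root_sum:
  fixes z :: "'a::idom"
  assumes "z ^ 5 = 1" "z \<noteq> 1"
  shows "1 + z + z ^ 2 + z ^ 3 + z ^ 4 = 0"
proof -
  have "(z - 1) * (1 + z + z ^ 2 + z ^ 3 + z ^ 4) = z ^ 5 - 1" by algebra
  thus ?thesis using assms by simp
qed

lemma fifth_root_power_neq_1:
  fixes z :: "'a::idom"
  assumes "z ^ 5 = 1" "z \<noteq> 1" "\<not> 5 dvd k"
  shows "z ^ k \<noteq> 1"
proof
  assume *: "z ^ k = 1"
  have "coprime k 5"
    using prime_imp_coprime[of 5 k] assms(3) by (simp add: coprime_commute)
  then obtain x y where "k * x = 5 * y + 1"
    using coprime_bezout_strong[of k 5] by auto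
  hence "z ^ (k * x) = z ^ (5 * y) * z" by simp
  thus False using assms * by (simp add: power_mult)
qed

text \<open>In \<open>euler_norm_finite\<close> the role of \<open>z\<close> is played by a power of
  a fifth root of unity, which may be trivial; hence the two cases.\<close>

lemma fifth_root_prod:
  fixes y z :: "'a::idom"
  assumes "z ^ 5 = 1"
  shows "(\<Prod>j<5. 1 - z ^ j * y) = (if z = 1 then (1 - y) ^ 5 else 1 - y ^ 5)"
proof (cases "z = 1")
  case False
  have "(\<Prod>j<5. 1 - z ^ j * y) = (1 - y) * (1 - z * y) * (1 - z ^ 2 * y) * (1 - z ^ 3 * y) * (1 - z ^ 4 * y)"
    by (simp add: eval_nat_numeral)
  also have "\<dots> = 1 - y ^ 5"
    using fifth_root_sum[OF assms False] by algebra
  finally show ?thesis using False by simp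
qed simp

lemma fps_X_power_dvd_compose_X_power:
  fixes f :: "'a::comm_ring_1 fps"
  assumes "fps_X ^ L dvd f" "d > 0"
  shows "fps_X ^ L dvd f oo fps_X ^ d"
  unfolding fps_X_power_dvd_iff
proof safe
  fix i assume "i < L"
  moreover have "i div d \<le> i" by simp
  ultimately have "f $ (i div d) = 0"
    using assms unfolding fps_X_power_dvd_iff by (meson le_less_trans)
  thus "(f oo fps_X ^ d) $ i = 0" by (simp add: fps_nth_compose_X_power)
qed

lemma euler_compose_cong:
  assumes "d > 0"
  shows "fps_X ^ Suc n dvd (of_int_fps euler oo fps_X ^ d :: 'a::idom fps) - (\<Prod>k=1..n. 1 - fps_X ^ (d * k))"
proof -
  have "fps_X ^ Suc n dvd (of_int_fps euler :: 'a fps) - of_int_fps (\<Prod>k=1..n. 1 - fps_X ^ k)"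
    using euler_cong[of n] unfolding fps_X_power_dvd_iff by simp
  also have "of_int_fps (\<Prod>k=1..n. 1 - fps_X ^ k) = (\<Prod>k=1..n. 1 - fps_X ^ k :: 'a fps)"
    by (simp add: of_int_fps_prod of_int_fps_diff of_int_fps_power)
  finally have "fps_X ^ Suc n dvd ((of_int_fps euler :: 'a fps) - (\<Prod>k=1..n. 1 - fps_X ^ k)) oo fps_X ^ d"
    by (rule fps_X_power_dvd_compose_X_power) fact
  also have "((of_int_fps euler :: 'a fps) - (\<Prod>k=1..n. 1 - fps_X ^ k)) oo fps_X ^ d
      = (of_int_fps euler oo fps_X ^ d) - (\<Prod>k=1..n. 1 - fps_X ^ (d * k))"
    using assms by (simp add: fps_compose_sub_distrib fps_compose_prod_distrib fps_X_power_compose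
        flip: power_mult)
  finally show ?thesis .
qed

lemma theta_compose:
  assumes "d > 0"
  shows "(of_int_fps theta :: 'a::idom fps) oo fps_X ^ d = fps_X ^ d * (of_int_fps euler oo fps_X ^ (24 * d))"
  using assms
  by (simp add: theta_eq_euler of_int_fps_mult of_int_fps_compose_X_power fps_compose_mult_distrib
      fps_compose_assoc[symmetric] fps_X_power_compose mult.commute[of d] flip: power_mult)

lemma theta_compose_cong:
  assumes "d > 0"
  shows "fps_X ^ Suc n dvd ((of_int_fps theta :: 'a::idom fps) oo fps_X ^ d) -
          fps_X ^ d * (\<Prod>k=1..n. 1 - fps_X ^ (24 * d * k))"
  unfolding theta_compose[OF assms]
  by (rule dvd_diff_mult) (use euler_compose_cong[of "24 * d" n, where 'a = 'a] assms in auto)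

text \<open>The substitution of z X for X. For a primitive fifth root of unity the five twists by
  its powers are conjugates, and their product is a norm to series in X^5.\<close>

definition twist :: "'a::comm_ring_1 \<Rightarrow> 'a fps \<Rightarrow> 'a fps" where
  "twist z f = Abs_fps (\<lambda>n. z ^ n * f $ n)"

lemma twist_nth [simp]: "twist z f $ n = z ^ n * f $ n"
  by (simp add: twist_def)

lemma twist_mult: "twist z (f * g) = twist z f * twist z g"
proof (rule fps_ext)
  fix n
  have "z ^ n * (f $ i * g $ (n - i)) = (z ^ i * f $ i) * (z ^ (n - i) * g $ (n - i))" if "i \<in> {0..n}" for i
  proof -
    have "z ^ n = z ^ i * z ^ (n - i)" using that by (simp flip: power_add)
    thus ?thesis by (simp add: mult_ac)
  qed
  thus "twist z (f * g) $ n = (twist z f * twist z g) $ n"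
    by (simp add: fps_mult_nth sum_distrib_left)
qed

lemma twist_diff: "twist z (f - g) = twist z f - twist z g"
  by (rule fps_ext) (simp add: algebra_simps)

lemma twist_uminus: "twist z (- f) = - twist z f"
  by (rule fps_ext) simp

lemma twist_1 [simp]: "twist z 1 = 1"
  by (rule fps_ext) simp

lemma twist_X_power: "twist z (fps_X ^ k) = fps_const (z ^ k) * fps_X ^ k"
  by (rule fps_ext) (simp add: fps_X_power_nth)

lemma twist_prod: "twist z (\<Prod>i\<in>A. f i) = (\<Prod>i\<in>A. twist z (f i))"
  by (induction A rule: infinite_finite_induct) (simp_all add: twist_mult)

text \<open>The conjugates of 1 - X^(24 k) multiply to 1 - X^(120 k), except that for k = 5 l they
  are all equal and give (1 - X^(120 l))^5. The factors 1 - X^(600 l) on the left fill the gaps at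
  the multiples of 5; this is why the lengths are \<open>5 * M\<close> and \<open>M\<close>.\<close>

lemma euler_norm_finite:
  fixes z :: "'a::idom"
  assumes "z ^ 5 = 1" "z \<noteq> 1"
  shows "(\<Prod>j<5. twist (z ^ j) (\<Prod>k=1..5 * M. 1 - fps_X ^ (24 * k))) * (\<Prod>k=1..M. 1 - fps_X ^ (600 * k))
     = (\<Prod>k=1..M. 1 - fps_X ^ (120 * k)) ^ 5 * (\<Prod>k=1..5 * M. 1 - fps_X ^ (120 * k))"
proof -
  define F where "F k = (if 5 dvd k then (1 - fps_X ^ (24 * k)) ^ 5 else 1 - fps_X ^ (120 * k) :: 'a fps)" for k :: nat
  have F: "(\<Prod>j<5. twist (z ^ j) (1 - fps_X ^ (24 * k))) = F k" for k
  proof -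
    define w where "w = fps_const (z ^ (24 * k))"
    have "z ^ (24 * k * 5) = (z ^ 5) ^ (24 * k)" by (simp only: power_mult[symmetric] mult_ac)
    hence w5: "w ^ 5 = 1"
      by (simp add: w_def fps_const_power assms mult_ac flip: power_mult)
    have "w = 1 \<longleftrightarrow> z ^ (24 * k) = 1"
    proof
      assume "w = 1"
      hence "w $ 0 = 1 $ 0" by simp
      thus "z ^ (24 * k) = 1" by (simp add: w_def)
    qed (simp add: w_def)
    also have "\<dots> \<longleftrightarrow> 5 dvd k"
    proof
      assume "5 dvd k"
      then obtain l where "k = 5 * l" by auto
      hence "z ^ (24 * k) = (z ^ 5) ^ (24 * l)" by (simp flip: power_mult)
      thus "z ^ (24 * k) = 1" by (simp add: assms)
    next
      assume "z ^ (24 * k) = 1"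
      hence "5 dvd 24 * k" using fifth_root_power_neq_1[OF assms] by blast
      thus "5 dvd k" by presburger
    qed
    finally have w1: "w = 1 \<longleftrightarrow> 5 dvd k" .
    have "(\<Prod>j<5. twist (z ^ j) (1 - fps_X ^ (24 * k))) = (\<Prod>j<5. 1 - w ^ j * fps_X ^ (24 * k))"
      by (simp add: twist_diff twist_X_power w_def fps_const_power mult_ac flip: power_mult)
    also have "\<dots> = F k"
      unfolding fifth_root_prod[OF w5] w1 F_def by (simp add: mult_ac flip: power_mult)
    finally show ?thesis .
  qed
  have "(\<Prod>j<5. twist (z ^ j) (\<Prod>k=1..5 * M. 1 - fps_X ^ (24 * k))) = (\<Prod>k=1..5 * M. F k)"
    unfolding twist_prod by (subst prod.swap) (simp only: F)
  moreover have "(\<Prod>k=1..5 * M. F k) * (\<Prod>k=1..M. 1 - fps_X ^ (600 * k))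
     = (\<Prod>k=1..M. 1 - fps_X ^ (120 * k)) ^ 5 * (\<Prod>k=1..5 * M. 1 - fps_X ^ (120 * k))"
  proof (induction M)
    case (Suc M)
    have step: "(\<Prod>k=1..n+5. f k) = (\<Prod>k=1..n. f k) * f (n+1) * f (n+2) * f (n+3) * f (n+4) * f (n+5)"
      for f :: "nat \<Rightarrow> 'a fps" and n by (simp add: eval_nat_numeral)
    have prod5: "(\<Prod>k=1..5 * Suc M. f k) = (\<Prod>k=1..5 * M. f k) * f (5*M+1) * f (5*M+2) * f (5*M+3) * f (5*M+4) * f (5 * (M+1))"
      for f :: "nat \<Rightarrow> 'a fps"
      using step[of f "5 * M"] by (simp add: add.commute)
    have F': "F (5*M+1) = 1 - fps_X ^ (120 * (5*M+1))" "F (5*M+2) = 1 - fps_X ^ (120 * (5*M+2))"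
      "F (5*M+3) = 1 - fps_X ^ (120 * (5*M+3))" "F (5*M+4) = 1 - fps_X ^ (120 * (5*M+4))"
      unfolding F_def by (simp_all only: if_False dvd_add_right_iff dvd_triv_left) simp_all
    have F5: "F (5 * (M+1)) = (1 - fps_X ^ (120 * (M+1))) ^ 5"
      unfolding F_def by (simp add: mult.assoc[symmetric] del: mult_Suc_right power_Suc distrib_left_numeral)
    have aux: "A * f1 * f2 * f3 * f4 * E ^ 5 * (B * f5) = (C * E) ^ 5 * (D * f1 * f2 * f3 * f4 * f5)"
      if "A * B = C ^ 5 * D" for A B C D E f1 f2 f3 f4 f5 :: "'a fps"
    proof -
      have "A * f1 * f2 * f3 * f4 * E ^ 5 * (B * f5) = (A * B) * (E ^ 5 * f1 * f2 * f3 * f4 * f5)"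
        by (simp only: mult_ac)
      thus ?thesis unfolding that by (simp only: power_mult_distrib mult_ac)
    qed
    have e: "600 * (M + 1) = 120 * (5 * (M + 1))" by simp
    have prod1: "(\<Prod>k=1..Suc M. f k) = (\<Prod>k=1..M. f k) * f (M + 1)" for f :: "nat \<Rightarrow> 'a fps"
      by simp
    show ?case
      unfolding prod5 prod1 F' F5 e by (rule aux[OF Suc.IH])
  qed simp
  ultimately show ?thesis by simp
qed

text \<open>Modulo X^(M + 1) every series is replaced by a truncated product, of the length that
  \<open>euler_norm_finite\<close> asks for.\<close>

lemma theta_norm:
  fixes z :: "'a::idom"
  assumes "z ^ 5 = 1" "z \<noteq> 1"
  defines "g \<equiv> of_int_fps theta :: 'a fps"
  shows "(\<Prod>j<5. twist (z ^ j) g) * (g oo fps_X ^ 25) = (g oo fps_X ^ 5) ^ 6"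
proof (rule fps_eq_if_X_power_dvd)
  fix M
  define P where "P d n = (\<Prod>k=1..n. 1 - fps_X ^ (24 * d * k) :: 'a fps)" for d n :: nat
  have cong: "fps_X ^ Suc M dvd (g oo fps_X ^ d) - fps_X ^ d * P d n" if "d > 0" "M \<le> n" for d n
  proof -
    have "fps_X ^ Suc M dvd (fps_X :: 'a fps) ^ Suc n" using that by (intro le_imp_power_dvd) simp
    thus ?thesis using theta_compose_cong[OF that(1), where n = n] unfolding g_def P_def
      by (rule dvd_trans)
  qed
  have twist_cong: "fps_X ^ Suc M dvd twist y g - twist y (fps_X ^ 1 * P 1 (5 * M))" for y
    using cong[of 1 "5 * M"] unfolding fps_X_power_dvd_iff by simp
  have "fps_X ^ Suc M dvd (\<Prod>j<5. twist (z ^ j) g) * (g oo fps_X ^ 25)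
      - (\<Prod>j<5. twist (z ^ j) (fps_X ^ 1 * P 1 (5 * M))) * (fps_X ^ 25 * P 25 M)"
    by (intro dvd_diff_mult dvd_diff_prod twist_cong cong) auto
  also have "(\<Prod>j<5. twist (z ^ j) (fps_X ^ 1 * P 1 (5 * M))) =
      (\<Prod>j<5. fps_const (z ^ j)) * fps_X ^ 5 * (\<Prod>j<5. twist (z ^ j) (P 1 (5 * M)))"
    unfolding twist_mult twist_X_power prod.distrib by simp
  \<comment> \<open>The exponents 0, ..., 4 add up to 10.\<close>
  also have "(\<Prod>j<5. fps_const (z ^ j)) = fps_const ((z ^ 5) ^ 2)"
    by (simp add: lessThan_nat_numeral lessThan_Suc flip: power_mult power_add power_Suc) (simp add: eval_nat_numeral)
  also have "fps_const ((z ^ 5) ^ 2) * fps_X ^ 5 * (\<Prod>j<5. twist (z ^ j) (P 1 (5 * M))) * (fps_X ^ 25 * P 25 M)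
      = fps_X ^ 30 * ((\<Prod>j<5. twist (z ^ j) (P 1 (5 * M))) * P 25 M)"
    by (simp add: assms mult_ac flip: power_add)
  also have "(\<Prod>j<5. twist (z ^ j) (P 1 (5 * M))) * P 25 M = P 5 M ^ 5 * P 5 (5 * M)"
    using euler_norm_finite[OF assms(1,2), of M] by (simp add: P_def)
  also have "fps_X ^ 30 * (P 5 M ^ 5 * P 5 (5 * M)) = (fps_X ^ 5 * P 5 M) ^ 5 * (fps_X ^ 5 * P 5 (5 * M))"
    by (simp add: power_mult_distrib mult_ac flip: power_mult power_add)
  finally have 1: "fps_X ^ Suc M dvd (\<Prod>j<5. twist (z ^ j) g) * (g oo fps_X ^ 25)
      - (fps_X ^ 5 * P 5 M) ^ 5 * (fps_X ^ 5 * P 5 (5 * M))" .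
  have "fps_X ^ Suc M dvd (g oo fps_X ^ 5) ^ 5 * (g oo fps_X ^ 5)
      - (fps_X ^ 5 * P 5 M) ^ 5 * (fps_X ^ 5 * P 5 (5 * M))"
    by (intro dvd_diff_mult dvd_diff_power cong) auto
  from dvd_diff[OF 1 this] show "fps_X ^ Suc M dvd
      (\<Prod>j<5. twist (z ^ j) g) * (g oo fps_X ^ 25) - (g oo fps_X ^ 5) ^ 6"
    by (simp add: eval_nat_numeral mult_ac)
qed

lemma twist_res_part:
  fixes z :: "'a::comm_ring_1"
  assumes "z ^ 5 = 1"
  shows "twist z (of_int_fps (res_part i f)) = fps_const (z ^ i) * of_int_fps (res_part i f)"
proof (rule fps_ext)
  fix n
  have "z ^ n = z ^ (n mod 5)"
  proof -
    have "z ^ n = z ^ (5 * (n div 5) + n mod 5)" by simp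
    also have "\<dots> = (z ^ 5) ^ (n div 5) * z ^ (n mod 5)" by (simp only: power_add power_mult)
    finally show ?thesis by (simp add: assms)
  qed
  thus "twist z (of_int_fps (res_part i f)) $ n = (fps_const (z ^ i) * of_int_fps (res_part i f)) $ n"
    by (auto simp: res_part_def)
qed

text \<open>The last identity computes one norm in two ways, from the dissection by
  \<open>fifth_root_norm\<close> and from the product by \<open>theta_norm\<close>.\<close>

theorem theta_parts_power_5:
  defines "g \<equiv> of_int_fps theta :: complex fps"
  defines "a \<equiv> of_int_fps (res_part 1 theta)" and "b \<equiv> - of_int_fps (res_part 4 theta)"
    and "c \<equiv> g oo fps_X ^ 25"
  shows "g = a - b - c" "a * b = c ^ 2" "c * (a ^ 5 - 11 * c ^ 5 - b ^ 5) = (g oo fps_X ^ 5) ^ 6"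
proof -
  have c: "c = - of_int_fps (res_part 0 theta)"
    by (simp add: c_def g_def res_part_0_theta of_int_fps_compose_X_power of_int_fps_uminus)
  show g: "g = a - b - c"
    unfolding g_def a_def b_def c_def
    by (subst theta_dissection) (simp add: of_int_fps_add of_int_fps_diff of_int_fps_compose_X_power)
  show ab: "a * b = c ^ 2"
  proof -
    have "a * b = - of_int_fps (res_part 1 theta * res_part 4 theta)"
      unfolding a_def b_def of_int_fps_mult by simp
    also have "\<dots> = c ^ 2"
      unfolding theta_parts_mult c of_int_fps_uminus of_int_fps_power by simp
    finally show ?thesis .
  qed
  define z where "z = cis (2 * pi / 5)"
  have z5: "z ^ 5 = 1"
    unfolding z_def Complex.DeMoivre by simp
  have z1: "z \<noteq> 1"
  proof
    assume "z = 1"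
    hence "cos (2 * pi / 5) = 1" by (simp add: z_def complex_eq_iff)
    moreover have "cos (2 * pi / 5) < cos 0" by (rule cos_monotone_0_pi) auto
    ultimately show False by simp
  qed
  define w where "w = fps_const z"
  have w5: "w ^ 5 = 1" and w1: "w \<noteq> 1"
    using z5 z1 by (auto simp: w_def fps_const_power fps_eq_iff intro!: exI[of _ 0])
  have tw: "twist (z ^ j) g = w ^ j * a - w ^ (4 * j) * b - c" for j
  proof -
    have zj: "(z ^ j) ^ 5 = 1" using z5 by (metis mult.commute power_mult power_one)
    have wj: "fps_const ((z ^ j) ^ i) = w ^ (i * j)" for i
      unfolding w_def fps_const_power by (metis mult.commute power_mult)
    have "twist (z ^ j) a = w ^ j * a" "twist (z ^ j) b = w ^ (4 * j) * b" "twist (z ^ j) c = c"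
      unfolding a_def b_def c twist_uminus twist_res_part[OF zj] wj by simp_all
    thus ?thesis unfolding g twist_diff by simp
  qed
  have red: "w ^ 8 = w ^ 3" "w ^ 12 = w ^ 2" "w ^ 16 = w"
    using w5 by algebra+
  have "(\<Prod>j<5. twist (z ^ j) g) = (a - b - c) * (w * a - w ^ 4 * b - c) * (w ^ 2 * a - w ^ 3 * b - c) *
         (w ^ 3 * a - w ^ 2 * b - c) * (w ^ 4 * a - w * b - c)"
    unfolding tw by (simp add: lessThan_nat_numeral lessThan_Suc red mult_ac)
  also have "\<dots> = a ^ 5 - 11 * c ^ 5 - b ^ 5"
    by (rule fifth_root_norm[OF fifth_root_sum[OF w5 w1] ab])
  finally show "c * (a ^ 5 - 11 * c ^ 5 - b ^ 5) = (g oo fps_X ^ 5) ^ 6"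
    using theta_norm[OF z5 z1] by (simp add: g_def c_def mult.commute)
qed

subsection \<open>Watson's quintic equation\<close>

definition decimate :: "'a::zero fls \<Rightarrow> 'a fls" where
  "decimate f = Abs_fls (\<lambda>n. f $$ (5 * n))"

abbreviation dilate :: "'a::zero fls \<Rightarrow> 'a fls" where
  "dilate f \<equiv> fls_compose_power f 5"

lemma decimate_nth [simp]: "decimate f $$ n = f $$ (5 * n)"
proof -
  \<comment> \<open>For negative n the index 5 n is below n, so the lower bound of \<open>f\<close>
    is inherited.\<close>
  have "\<forall>n<min 0 (fls_subdegree f). f $$ (5 * n) = 0"
    by auto
  thus ?thesis unfolding decimate_def by (intro nth_Abs_fls_ex_lower_bound) blast
qed

lemma fls_times_nth_bounds:
  fixes f g :: "'a::semiring_0 fls"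
  assumes "\<And>i. i < a \<Longrightarrow> f $$ i = 0" "\<And>i. i < b \<Longrightarrow> g $$ i = 0"
  shows "(f * g) $$ n = (\<Sum>i=a..n - b. f $$ i * g $$ (n - i))"
proof (cases "f = 0 \<or> g = 0")
  case False
  hence "a \<le> fls_subdegree f" "b \<le> fls_subdegree g"
    using assms by (auto intro!: fls_subdegree_geI)
  thus ?thesis unfolding fls_times_nth(2)
    by (intro sum.mono_neutral_left) auto
qed auto

text \<open>The projection formula for \<open>U\<close>: \<open>dilate x\<close> contributes only at
  multiples of 5, where the index can be divided by 5.\<close>

lemma decimate_dilate_mult:
  fixes x y :: "'a::idom fls"
  shows "decimate (dilate x * y) = x * decimate y"
proof (rule fls_eqI)
  fix n
  \<comment> \<open>\<open>b\<close> is rounded down, so that 5 b still bounds the support of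
    \<open>y\<close> from below.\<close>
  define a b where "a = fls_subdegree x" and "b = fls_subdegree y div 5"
  have x0: "x $$ i = 0" if "i < a" for i using that by (simp add: a_def)
  have y0: "y $$ i = 0" if "i < 5 * b" for i using that unfolding b_def by (intro fls_eq0_below_subdegree) linarith
  have "decimate (dilate x * y) $$ n = (\<Sum>i=5*a..5*n - 5*b. dilate x $$ i * y $$ (5*n - i))"
    unfolding decimate_nth
    by (rule fls_times_nth_bounds) (use x0 y0 in \<open>auto simp: fls_nth_compose_power\<close>)
  also have "\<dots> = (\<Sum>i\<in>(\<lambda>j. 5 * j) ` {a..n - b}. dilate x $$ i * y $$ (5*n - i))"
  proof (rule sum.mono_neutral_right)
    show "\<forall>i\<in>{5 * a..5 * n - 5 * b} - (\<lambda>j. 5 * j) ` {a..n - b}. dilate x $$ i * y $$ (5 * n - i) = 0"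
    proof
      fix i assume i: "i \<in> {5 * a..5 * n - 5 * b} - (\<lambda>j. 5 * j) ` {a..n - b}"
      have "\<not> 5 dvd i"
      proof
        assume "5 dvd i"
        then obtain j where "i = 5 * j" by auto
        thus False using i by auto
      qed
      thus "dilate x $$ i * y $$ (5 * n - i) = 0" by (simp add: fls_nth_compose_power)
    qed
  qed auto
  also have "\<dots> = (\<Sum>j=a..n - b. x $$ j * decimate y $$ (n - j))"
    by (subst sum.reindex) (auto simp: inj_on_def fls_nth_compose_power algebra_simps)
  also have "\<dots> = (x * decimate y) $$ n"
    by (rule fls_times_nth_bounds[symmetric]) (use x0 y0 in auto)
  finally show "decimate (dilate x * y) $$ n = (x * decimate y) $$ n" .
qed

lemma decimate_add: "decimate (f + g) = decimate f + (decimate g :: 'a::monoid_add fls)"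
  by (rule fls_eqI) simp

lemma decimate_diff: "decimate (f - g) = decimate f - (decimate g :: 'a::group_add fls)"
  by (rule fls_eqI) simp

lemma decimate_0 [simp]: "decimate 0 = 0"
  by (rule fls_eqI) simp

lemma decimate_1 [simp]: "decimate (1 :: 'a::zero_neq_one fls) = 1"
  by (rule fls_eqI) simp

lemma decimate_sum: "decimate (\<Sum>i\<in>A. f i) = (\<Sum>i\<in>A. decimate (f i) :: 'a::comm_monoid_add fls)"
  by (induction A rule: infinite_finite_induct) (simp_all add: decimate_add)

lemma decimate_of_int_mult: "decimate (of_int c * f) = of_int c * (decimate f :: 'a::idom fls)"
  by (rule fls_eqI) (simp add: fls_of_int)

lemma decimate_numeral_mult: "decimate (numeral k * f) = numeral k * (decimate f :: 'a::idom fls)"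
  using decimate_of_int_mult[of "numeral k" f] by simp

lemma dilate_inverse: "dilate (inverse x) = inverse (dilate x :: 'a::field fls)"
proof (cases "x = 0")
  case False
  hence "dilate x * dilate (inverse x) = 1"
    by (simp flip: fls_compose_power_mult)
  thus ?thesis by (metis inverse_unique)
qed simp

lemma dilate_divide: "dilate (x / y) = dilate x / (dilate y :: 'a::field fls)"
  by (simp add: divide_inverse dilate_inverse)

lemma dilate_power_int: "dilate (x powi n) = (dilate x :: 'a::field fls) powi n"
  by (simp add: power_int_def dilate_inverse)

section \<open>Eta quotients as Laurent series\<close>

definition eta :: "complex fls" where "eta = fps_to_fls (of_int_fps theta)"
definition eta5 :: "complex fls" where "eta5 = dilate eta"
definition eta25 :: "complex fls" where "eta25 = dilate eta5"

lemma eta_neq_0 [simp]: "eta \<noteq> 0"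
proof
  assume "eta = 0"
  hence "eta $$ 1 = 0" by simp
  moreover have "{s::nat. s\<^sup>2 = 1} = {1}" by (auto simp: power2_eq_square)
  ultimately show False by (simp add: eta_def theta_def chi_def)
qed

lemma dilate_eq_0_iff [simp]: "dilate x = 0 \<longleftrightarrow> (x :: 'a::field fls) = 0"
proof
  assume *: "dilate x = 0"
  show "x = 0"
  proof (rule fls_eqI)
    fix n
    have "dilate x $$ (5 * n) = x $$ n" by (simp add: fls_nth_compose_power)
    thus "x $$ n = 0 $$ n" using * by simp
  qed
qed simp

lemma eta5_neq_0 [simp]: "eta5 \<noteq> 0" and eta25_neq_0 [simp]: "eta25 \<noteq> 0"
  by (simp_all add: eta5_def eta25_def)

definition eta_tau :: "complex fls" where "eta_tau = (eta / eta5) ^ 6"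
definition eta_Y :: "complex fls" where "eta_Y = eta / eta25"

lemma eta_tau_neq_0 [simp]: "eta_tau \<noteq> 0" and eta_Y_neq_0 [simp]: "eta_Y \<noteq> 0"
  by (simp_all add: eta_tau_def eta_Y_def)

text \<open>Exponents modulo 5 grade the ring of power series.\<close>

lemma res_part_mult_nth:
  assumes "\<And>n. n mod 5 \<noteq> i mod 5 \<Longrightarrow> f $ n = 0" "\<And>n. n mod 5 \<noteq> j mod 5 \<Longrightarrow> g $ n = 0"
    and "n mod 5 \<noteq> (i + j) mod 5"
  shows "(f * g :: 'a::comm_ring_1 fps) $ n = 0"
  unfolding fps_mult_nth
proof (rule sum.neutral, rule ballI)
  fix k assume k: "k \<in> {0..n}"
  have "k mod 5 \<noteq> i mod 5 \<or> (n - k) mod 5 \<noteq> j mod 5"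
  proof (rule ccontr)
    assume "\<not> (k mod 5 \<noteq> i mod 5 \<or> (n - k) mod 5 \<noteq> j mod 5)"
    hence "(k + (n - k)) mod 5 = (i + j) mod 5" by (intro mod_add_cong) auto
    thus False using assms(3) k by simp
  qed
  thus "f $ k * g $ (n - k) = 0" using assms(1,2) by auto
qed

lemma res_part_power_nth:
  assumes "\<And>n. n mod 5 \<noteq> i mod 5 \<Longrightarrow> f $ n = 0" "n mod 5 \<noteq> (k * i) mod 5"
  shows "(f ^ k :: 'a::comm_ring_1 fps) $ n = 0"
  using assms(2)
proof (induction k arbitrary: n)
  case 0
  thus ?case by (cases "n = 0") auto
next
  case (Suc k)
  thus ?case using res_part_mult_nth[of i f "k * i" "f ^ k" n] assms(1) by auto
qed

lemma decimate_power_eq_0: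
  assumes "\<And>n. n mod 5 \<noteq> i mod 5 \<Longrightarrow> f $ n = 0" "\<not> 5 dvd k * i"
  shows "decimate (fps_to_fls (f ^ k) :: 'a::comm_ring_1 fls) = 0"
proof (rule fls_eqI)
  fix n
  have "(f ^ k) $ nat (5 * n) = 0" if "n \<ge> 0"
  proof (rule res_part_power_nth[OF assms(1)])
    have "nat (5 * n) mod 5 = 0" using that by (simp add: nat_mult_distrib)
    thus "nat (5 * n) mod 5 \<noteq> k * i mod 5" using assms(2) by (simp add: dvd_eq_mod_eq_0)
  qed
  thus "decimate (fps_to_fls (f ^ k)) $$ n = 0 $$ n" by simp
qed

text \<open>After division by \<open>eta25\<close> the parts satisfy a b = 1 and Y = a - 1 / a - 1.
  So a^5 - 11 - 1 / a^5, being invariant under a to - 1 / a, is a polynomial in Y. As a^k and b^k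
  decimate to 0 for k from 1 to 4, decimating Y^n leaves only its constant term.\<close>

lemma eta_quintic:
  "eta_Y ^ 5 + 5 * eta_Y ^ 4 + 15 * eta_Y ^ 3 + 25 * eta_Y ^ 2 + 25 * eta_Y = dilate eta_tau" (is ?quintic)
  and decimate_eta_Y: "decimate eta_Y = - 1"
  and decimate_eta_Y2: "decimate (eta_Y ^ 2) = - 1"
  and decimate_eta_Y3: "decimate (eta_Y ^ 3) = 5"
  and decimate_eta_Y4: "decimate (eta_Y ^ 4) = - 5"
proof -
  define g where "g = (of_int_fps theta :: complex fps)"
  define a0 where "a0 = (of_int_fps (res_part 1 theta) :: complex fps)"
  define b0 where "b0 = (- of_int_fps (res_part 4 theta) :: complex fps)"
  define a where "a = fps_to_fls a0 / eta25"
  define b where "b = fps_to_fls b0 / eta25"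
  have eta5: "eta5 = fps_to_fls (g oo fps_X ^ 5)"
    by (simp add: eta5_def eta_def fls_compose_power_fps_to_fls g_def)
  have eta25: "eta25 = fps_to_fls (g oo fps_X ^ 25)"
    by (simp add: eta25_def eta5 fls_compose_power_fps_to_fls fps_compose_assoc[symmetric]
        fps_X_power_compose flip: power_mult)
  note th = theta_parts_power_5[folded g_def a0_def b0_def]
  have "eta = fps_to_fls a0 - fps_to_fls b0 - eta25"
    using arg_cong[OF th(1), of fps_to_fls] by (simp add: eta_def eta25 flip: g_def)
  hence Y: "eta_Y = a - b - 1"
    by (simp add: eta_Y_def a_def b_def field_simps)
  have "fps_to_fls a0 * fps_to_fls b0 = eta25 ^ 2"
    using arg_cong[OF th(2), of fps_to_fls] by (simp add: eta25 fls_times_fps_to_fls fps_to_fls_power)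
  hence ab: "a * b = 1"
    by (simp add: a_def b_def power2_eq_square)
  have "eta25 * (fps_to_fls a0 ^ 5 - 11 * eta25 ^ 5 - fps_to_fls b0 ^ 5) = eta5 ^ 6"
    using arg_cong[OF th(3), of fps_to_fls]
    by (simp add: eta25 eta5 fls_times_fps_to_fls fps_to_fls_power)
  hence "eta25 ^ 6 * (a ^ 5 - 11 - b ^ 5) = eta5 ^ 6"
    by (simp add: a_def b_def field_simps eval_nat_numeral)
  hence *: "a ^ 5 - 11 - b ^ 5 = (eta5 / eta25) ^ 6"
    by (simp add: field_simps)
  have "eta_Y ^ 5 + 5 * eta_Y ^ 4 + 15 * eta_Y ^ 3 + 25 * eta_Y ^ 2 + 25 * eta_Y = a ^ 5 - 11 - b ^ 5"
    unfolding Y using ab by algebra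
  also have "\<dots> = dilate eta_tau"
    unfolding * eta_tau_def by (simp add: dilate_divide flip: eta5_def eta25_def)
  finally show ?quintic .
  have dk: "dilate (inverse eta5 ^ k) = inverse eta25 ^ k" for k
    by (simp add: dilate_inverse flip: eta25_def)
  have a: "decimate (a ^ k) = 0" if "k \<in> {1..4}" for k
  proof -
    \<comment> \<open>The denominator is a dilated series and can be pulled out; only the exponents
      of \<open>a0 ^ k\<close> modulo 5 matter.\<close>
    have "a ^ k = dilate (inverse eta5 ^ k) * fps_to_fls (a0 ^ k)"
      by (simp only: dk a_def divide_inverse power_mult_distrib fps_to_fls_power mult.commute)
    moreover have "decimate (fps_to_fls (a0 ^ k)) = 0"
      by (rule decimate_power_eq_0[of 1]) (use that in \<open>auto simp: a0_def res_part_def dest: dvd_imp_le\<close>)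
    ultimately show ?thesis by (simp only: decimate_dilate_mult mult_zero_right)
  qed
  have b: "decimate (b ^ k) = 0" if "k \<in> {1..4}" for k
  proof -
    have "b ^ k = dilate (inverse eta5 ^ k) * fps_to_fls (b0 ^ k)"
      by (simp only: dk b_def divide_inverse power_mult_distrib fps_to_fls_power mult.commute)
    moreover have "\<not> 5 dvd k * 4" using that by auto presburger
    hence "decimate (fps_to_fls (b0 ^ k)) = 0"
      by (intro decimate_power_eq_0[of 4]) (auto simp: b0_def res_part_def)
    ultimately show ?thesis by (simp only: decimate_dilate_mult mult_zero_right)
  qed
  note simps = decimate_add decimate_diff decimate_numeral_mult a[of 1, simplified] a[of 2] a[of 3] a[of 4]
    b[of 1, simplified] b[of 2] b[of 3] b[of 4]
  have num: "decimate (numeral k :: complex fls) = numeral k" for k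
    using decimate_numeral_mult[of k 1] by simp
  show "decimate eta_Y = - 1"
    unfolding Y by (simp add: simps)
  have "eta_Y ^ 2 = a ^ 2 + b ^ 2 - 2 * a + 2 * b - 1"
    unfolding Y using ab by algebra
  thus "decimate (eta_Y ^ 2) = - 1" by (simp add: simps)
  have "eta_Y ^ 3 = a ^ 3 - b ^ 3 - 3 * a ^ 2 - 3 * b ^ 2 + 5"
    unfolding Y using ab by algebra
  thus "decimate (eta_Y ^ 3) = 5" by (simp add: simps num)
  have "eta_Y ^ 4 = a ^ 4 + b ^ 4 - 4 * a ^ 3 + 4 * b ^ 3 + 2 * a ^ 2 + 2 * b ^ 2 + 8 * a - 8 * b - 5"
    unfolding Y using ab by algebra
  thus "decimate (eta_Y ^ 4) = - 5" by (simp add: simps num)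
qed

subsection \<open>Injectivity modulo a prime\<close>

text \<open>With \<open>\<tau> = eta_tau\<close> these satisfy \<open>decimate (eta_Y ^ n) = eta_Y_poly n (\<tau>)\<close> and
  \<open>decimate (inverse eta_Y ^ n) = eta_Y_inverse_poly n (1 / \<tau>)\<close>. Both recursions are Watson's quintic multiplied by a
  power of \<open>eta_Y\<close>; the initial values of \<open>eta_Y_inverse_poly\<close> follow by running it backwards from those of \<open>eta_Y_poly\<close>.\<close>

fun eta_Y_poly :: "nat \<Rightarrow> int poly" where
  "eta_Y_poly 0 = 1"
| "eta_Y_poly (Suc 0) = [:- 1:]"
| "eta_Y_poly (Suc (Suc 0)) = [:- 1:]"
| "eta_Y_poly (Suc (Suc (Suc 0))) = [:5:]"
| "eta_Y_poly (Suc (Suc (Suc (Suc 0)))) = [:- 5:]"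
| "eta_Y_poly (Suc (Suc (Suc (Suc (Suc n))))) =
     pCons 0 (eta_Y_poly n) - smult 5 (eta_Y_poly (Suc (Suc (Suc (Suc n))))) - smult 15 (eta_Y_poly (Suc (Suc (Suc n))))
     - smult 25 (eta_Y_poly (Suc (Suc n))) - smult 25 (eta_Y_poly (Suc n))"

fun eta_Y_inverse_poly :: "nat \<Rightarrow> int poly" where
  "eta_Y_inverse_poly 0 = 1"
| "eta_Y_inverse_poly (Suc 0) = [:0, 5:]"
| "eta_Y_inverse_poly (Suc (Suc 0)) = [:0, 10, 125:]"
| "eta_Y_inverse_poly (Suc (Suc (Suc 0))) = [:0, 9, 375, 3125:]"
| "eta_Y_inverse_poly (Suc (Suc (Suc (Suc 0)))) = [:0, 4, 550, 12500, 78125:]"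
| "eta_Y_inverse_poly (Suc (Suc (Suc (Suc (Suc n))))) =
     pCons 0 (eta_Y_inverse_poly n + smult 5 (eta_Y_inverse_poly (Suc n)) + smult 15 (eta_Y_inverse_poly (Suc (Suc n)))
     + smult 25 (eta_Y_inverse_poly (Suc (Suc (Suc n)))) + smult 25 (eta_Y_inverse_poly (Suc (Suc (Suc (Suc n))))))"

section \<open>Evaluation of integer polynomials at eta quotients\<close>

definition int_poly_eval :: "int poly \<Rightarrow> 'a::comm_ring_1 \<Rightarrow> 'a" where
  "int_poly_eval p x = poly (map_poly of_int p) x"

lemma int_poly_eval_pCons [simp]: "int_poly_eval (pCons a p) x = of_int a + x * int_poly_eval p x"
  by (simp add: int_poly_eval_def map_poly_pCons)

lemma int_poly_eval_0 [simp]: "int_poly_eval 0 x = 0"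
  by (simp add: int_poly_eval_def)

lemma int_poly_eval_1 [simp]: "int_poly_eval 1 x = 1"
  by (simp add: one_pCons)

lemma int_poly_eval_add [simp]: "int_poly_eval (p + q) x = int_poly_eval p x + int_poly_eval q x"
  by (induction p q rule: poly_induct2) (simp_all add: algebra_simps)

lemma int_poly_eval_smult [simp]: "int_poly_eval (smult c p) x = of_int c * int_poly_eval p x"
  by (induction p) (simp_all add: algebra_simps)

lemma int_poly_eval_diff [simp]: "int_poly_eval (p - q) x = int_poly_eval p x - int_poly_eval q x"
proof -
  have "p - q = p + smult (- 1) q" by simp
  thus ?thesis by (simp only: int_poly_eval_add int_poly_eval_smult) simp
qed

lemma int_poly_eval_eq_sum:
  assumes "\<And>i. i > n \<Longrightarrow> coeff p i = 0"
  shows "int_poly_eval p x = (\<Sum>i\<le>n. of_int (coeff p i) * x ^ i)"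
  using assms
proof (induction p arbitrary: n)
  case (pCons a p)
  have eq: "int_poly_eval p x = (\<Sum>i\<le>n - 1. of_int (coeff p i) * x ^ i)"
    by (rule pCons.IH) (use pCons.prems[of "Suc _"] in auto)
  show ?case
  proof (cases n)
    case 0
    hence "coeff p i = 0" for i using pCons.prems[of "Suc i"] by simp
    hence "p = 0" by (simp add: poly_eq_iff)
    thus ?thesis using 0 by simp
  next
    case (Suc k)
    thus ?thesis using eq
      by (simp add: sum.atMost_Suc_shift sum_distrib_left algebra_simps del: sum.atMost_Suc)
  qed
qed simp

text \<open>The projection formula turns the factor \<open>dilate eta_tau\<close> of the quintic
  into \<open>eta_tau\<close>, the variable of the polynomial.\<close>

lemma decimate_eta_Y_power:
  "decimate (eta_Y ^ n) = int_poly_eval (eta_Y_poly n) eta_tau"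
proof (induction n rule: eta_Y_poly.induct)
  case (6 n)
  have "eta_Y ^ Suc (Suc (Suc (Suc (Suc n)))) = eta_Y ^ 5 * eta_Y ^ n"
    by (simp add: eval_nat_numeral)
  also have "eta_Y ^ 5 = dilate eta_tau - 5 * eta_Y ^ 4 - 15 * eta_Y ^ 3 - 25 * eta_Y ^ 2 - 25 * eta_Y"
    unfolding eta_quintic[symmetric] by simp
  also have "\<dots> * eta_Y ^ n = dilate eta_tau * eta_Y ^ n - 5 * eta_Y ^ Suc (Suc (Suc (Suc n)))
      - 15 * eta_Y ^ Suc (Suc (Suc n)) - 25 * eta_Y ^ Suc (Suc n) - 25 * eta_Y ^ Suc n"
    by (simp add: algebra_simps eval_nat_numeral)
  finally show ?case
    by (simp add: decimate_diff decimate_dilate_mult decimate_numeral_mult 6 del: power_Suc)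
qed (use decimate_eta_Y decimate_eta_Y2 decimate_eta_Y3 decimate_eta_Y4 in \<open>simp_all add: numeral_eq_Suc\<close>)

lemma decimate_eta_Y_inverse_power:
  "decimate (inverse eta_Y ^ n) = int_poly_eval (eta_Y_inverse_poly n) (inverse eta_tau)"
proof -
  define Z where "Z = inverse eta_Y"
  define s where "s = inverse eta_tau"
  have YZ: "eta_Y * Z = 1" by (simp add: Z_def)
  have "dilate eta_tau * dilate s = 1"
    by (simp add: s_def dilate_inverse)
  hence Z: "Z ^ 5 = dilate s * (1 + 5 * Z + 15 * Z ^ 2 + 25 * Z ^ 3 + 25 * Z ^ 4)"
    using eta_quintic YZ by algebra
  \<comment> \<open>The quintic times \<open>dilate s * Z ^ k\<close>, for k from 1 to 4. On the
    right stand only powers whose decimation is already known.\<close>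
  have Zs: "Z = dilate s * (eta_Y ^ 4 + 5 * eta_Y ^ 3 + 15 * eta_Y ^ 2 + 25 * eta_Y + 25 * 1)"
    "Z ^ 2 = dilate s * (eta_Y ^ 3 + 5 * eta_Y ^ 2 + 15 * eta_Y + 25 * 1 + 25 * Z)"
    "Z ^ 3 = dilate s * (eta_Y ^ 2 + 5 * eta_Y + 15 * 1 + 25 * Z + 25 * Z ^ 2)"
    "Z ^ 4 = dilate s * (eta_Y + 5 * 1 + 15 * Z + 25 * Z ^ 2 + 25 * Z ^ 3)"
    using Z YZ by algebra+
  note simps = decimate_dilate_mult decimate_add decimate_numeral_mult
    decimate_eta_Y decimate_eta_Y2 decimate_eta_Y3 decimate_eta_Y4 decimate_1
  have Z1: "decimate Z = 5 * s"
    by (subst Zs(1)) (simp add: simps del: mult_1_right)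
  have Z2: "decimate (Z ^ 2) = 10 * s + 125 * s ^ 2"
    by (subst Zs(2)) (simp add: simps Z1 del: mult_1_right, simp add: algebra_simps power2_eq_square)
  have Z3: "decimate (Z ^ 3) = 9 * s + 375 * s ^ 2 + 3125 * s ^ 3"
    by (subst Zs(3)) (simp add: simps Z1 Z2 del: mult_1_right, simp add: algebra_simps eval_nat_numeral)
  have Z4: "decimate (Z ^ 4) = 4 * s + 550 * s ^ 2 + 12500 * s ^ 3 + 78125 * s ^ 4"
    by (subst Zs(4)) (simp add: simps Z1 Z2 Z3 del: mult_1_right, simp add: algebra_simps eval_nat_numeral)
  have "decimate (Z ^ n) = int_poly_eval (eta_Y_inverse_poly n) s"
  proof (induction n rule: eta_Y_inverse_poly.induct)
    case 2
    show ?case using Z1 by (simp add: mult.commute)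
  next
    case 3
    show ?case using Z2 by (simp add: algebra_simps eval_nat_numeral)
  next
    case 4
    show ?case using Z3 by (simp add: algebra_simps eval_nat_numeral)
  next
    case 5
    show ?case using Z4 by (simp add: algebra_simps eval_nat_numeral)
  next
    case (6 n)
    have "Z ^ Suc (Suc (Suc (Suc (Suc n)))) = Z ^ 5 * Z ^ n"
      by (simp add: eval_nat_numeral)
    also have "\<dots> = dilate s * (Z ^ n + 5 * Z ^ Suc n + 15 * Z ^ Suc (Suc n)
        + 25 * Z ^ Suc (Suc (Suc n)) + 25 * Z ^ Suc (Suc (Suc (Suc n))))"
      unfolding Z by (simp add: algebra_simps eval_nat_numeral)
    finally show ?case
      by (simp add: decimate_add decimate_dilate_mult decimate_numeral_mult 6 del: power_Suc)
  qed simp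
  thus ?thesis by (simp add: Z_def s_def)
qed

text \<open>The quintic trades five factors \<open>eta_Y\<close> for one
  \<open>dilate eta_tau\<close>, so the degree grows by at most one per five indices.\<close>

lemma eta_Y_poly_coeff_eq_0: "n < 5 * i \<Longrightarrow> coeff (eta_Y_poly n) i = 0"
proof (induction n arbitrary: i rule: eta_Y_poly.induct)
  case (6 n)
  then obtain j where "i = Suc j" by (cases i) auto
  thus ?case using 6 by simp
qed (auto split: nat.splits simp: coeff_pCons)

lemma eta_Y_poly_top_coeff: "coeff (eta_Y_poly (5 * k)) k = 1"
proof (induction k)
  case (Suc k)
  have "5 * Suc k = Suc (Suc (Suc (Suc (Suc (5 * k)))))" by simp
  thus ?case using Suc by (simp add: eta_Y_poly_coeff_eq_0 del: mult_Suc_right)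
qed simp

text \<open>The \<open>pCons 0\<close> term misses the constant coefficient, which thus obeys a
  linear recursion of order four; ten steps multiply four consecutive values by 5^5. The point is
  that only signed powers of 5 occur at indices prime to 5.\<close>

lemma eta_Y_poly_coeff_0:
  "coeff (eta_Y_poly (10 * k + 1)) 0 = - (5 ^ (5 * k)) \<and>
   coeff (eta_Y_poly (10 * k + 2)) 0 = - (5 ^ (5 * k)) \<and>
   coeff (eta_Y_poly (10 * k + 3)) 0 = 5 ^ (5 * k + 1) \<and>
   coeff (eta_Y_poly (10 * k + 4)) 0 = - (5 ^ (5 * k + 1)) \<and>
   coeff (eta_Y_poly (10 * k + 5)) 0 = 0 \<and>
   coeff (eta_Y_poly (10 * k + 6)) 0 = - (5 ^ (5 * k + 2)) \<and>
   coeff (eta_Y_poly (10 * k + 7)) 0 = 5 ^ (5 * k + 3) \<and>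
   coeff (eta_Y_poly (10 * k + 8)) 0 = - (5 ^ (5 * k + 3)) \<and>
   coeff (eta_Y_poly (10 * k + 9)) 0 = - (5 ^ (5 * k + 4))" (is "?P k")
proof -
  define c where "c n = coeff (eta_Y_poly n) 0" for n
  have rec: "c (n + 5) = - 5 * c (n + 4) - 15 * c (n + 3) - 25 * c (n + 2) - 25 * c (n + 1)" for n
    by (simp add: c_def eval_nat_numeral)
  have block: "c (n + 5) = 0 \<and> c (n + 6) = - 25 * x \<and> c (n + 7) = 125 * x \<and> c (n + 8) = - 125 * x \<and>
      c (n + 9) = - 625 * x \<and> c (n + 10) = 2500 * x \<and> c (n + 11) = - 3125 * x \<and> c (n + 12) = - 3125 * x
      \<and> c (n + 13) = 15625 * x \<and> c (n + 14) = - 15625 * x"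
    if "c (n + 1) = - x" "c (n + 2) = - x" "c (n + 3) = 5 * x" "c (n + 4) = - 5 * x" for n x
  proof -
    define d where "d i = c (n + i)" for i
    have rec': "d (i + 5) = - 5 * d (i + 4) - 15 * d (i + 3) - 25 * d (i + 2) - 25 * d (i + 1)" for i
      using rec[of "n + i"] by (simp add: d_def add.assoc)
    have d: "d 1 = - x" "d 2 = - x" "d 3 = 5 * x" "d 4 = - 5 * x"
      using that by (simp_all add: d_def)
    have 5: "d 5 = 0" using rec'[of 0] d by (simp add: eval_nat_numeral)
    have 6: "d 6 = - 25 * x" using rec'[of 1] d 5 by (simp add: eval_nat_numeral)
    have 7: "d 7 = 125 * x" using rec'[of 2] d 5 6 by (simp add: eval_nat_numeral)
    have 8: "d 8 = - 125 * x" using rec'[of 3] d 5 6 7 by (simp add: eval_nat_numeral)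
    have 9: "d 9 = - 625 * x" using rec'[of 4] d 5 6 7 8 by (simp add: eval_nat_numeral)
    have 10: "d 10 = 2500 * x" using rec'[of 5] d 5 6 7 8 9 by (simp add: eval_nat_numeral)
    have 11: "d 11 = - 3125 * x" using rec'[of 6] d 5 6 7 8 9 10 by (simp add: eval_nat_numeral)
    have 12: "d 12 = - 3125 * x" using rec'[of 7] d 5 6 7 8 9 10 11 by (simp add: eval_nat_numeral)
    have 13: "d 13 = 15625 * x" using rec'[of 8] d 5 6 7 8 9 10 11 12 by (simp add: eval_nat_numeral)
    have 14: "d 14 = - 15625 * x" using rec'[of 9] d 5 6 7 8 9 10 11 12 13 by (simp add: eval_nat_numeral)
    show ?thesis using 5 6 7 8 9 10 11 12 13 14 unfolding d_def by blast
  qed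
  have start: "c (10 * k + 1) = - (5 ^ (5 * k)) \<and> c (10 * k + 2) = - (5 ^ (5 * k)) \<and>
      c (10 * k + 3) = 5 * (5 ^ (5 * k)) \<and> c (10 * k + 4) = - 5 * (5 ^ (5 * k))"
  proof (induction k)
    case 0
    show ?case by (simp add: c_def eval_nat_numeral)
  next
    case (Suc k)
    have pow: "(5::int) ^ (5 * Suc k) = 3125 * 5 ^ (5 * k)"
      by (simp add: power_add)
    have e: "10 * Suc k + 1 = 10 * k + 11" "10 * Suc k + 2 = 10 * k + 12"
      "10 * Suc k + 3 = 10 * k + 13" "10 * Suc k + 4 = 10 * k + 14" by simp_all
    show ?case unfolding e pow using block[of "10 * k" "5 ^ (5 * k)"] Suc.IH by simp
  qed
  show ?thesis
    using start block[of "10 * k" "5 ^ (5 * k)"] by (simp add: power_add flip: c_def)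
qed

lemma eta_Y_poly_coeff_0_not_dvd:
  assumes "prime p" "p \<noteq> 5" "\<not> 5 dvd n"
  shows "\<not> int p dvd coeff (eta_Y_poly n) 0"
proof -
  have "n = 10 * (n div 10) + n mod 10" by simp
  moreover have "n mod 10 \<in> {1, 2, 3, 4, 6, 7, 8, 9}"
    using assms(3) by (simp, presburger)
  ultimately have "\<exists>e. coeff (eta_Y_poly n) 0 = 5 ^ e \<or> coeff (eta_Y_poly n) 0 = - (5 ^ e)"
    using eta_Y_poly_coeff_0[of "n div 10"] by (smt (verit) insertE empty_iff)
  moreover have "\<not> int p dvd 5 ^ e" for e
  proof
    assume "int p dvd 5 ^ e"
    hence "int p dvd int (5 ^ e)" by simp
    hence "p dvd 5 ^ e" by (simp only: of_nat_dvd_iff)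
    hence "p dvd 5" using assms(1) by (rule prime_dvd_power[rotated])
    moreover have "prime (5::nat)" by simp
    ultimately show False using assms(1,2) primes_dvd_imp_eq by blast
  qed
  ultimately show ?thesis by auto
qed

text \<open>Each use of the recursion brings one factor of the variable and lowers the index by one
  to five.\<close>

lemma eta_Y_inverse_poly_coeff_eq_0: "5 * j < n \<or> n < j \<Longrightarrow> coeff (eta_Y_inverse_poly n) j = 0"
proof (induction n arbitrary: j rule: eta_Y_inverse_poly.induct)
  case (6 n)
  show ?case
  proof (cases j)
    case (Suc i)
    hence i: "5 * i < n \<or> Suc (Suc (Suc (Suc n))) < i" using "6.prems" by auto
    have "coeff (eta_Y_inverse_poly n) i = 0" "coeff (eta_Y_inverse_poly (Suc n)) i = 0" "coeff (eta_Y_inverse_poly (Suc (Suc n))) i = 0"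
      "coeff (eta_Y_inverse_poly (Suc (Suc (Suc n)))) i = 0" "coeff (eta_Y_inverse_poly (Suc (Suc (Suc (Suc n))))) i = 0"
      using i by (intro "6.IH"; force)+
    thus ?thesis by (simp add: Suc)
  qed simp
qed (auto split: nat.splits simp: coeff_pCons)

text \<open>Only the last summand of the recursion, with its factor 25, reaches the top
  degree.\<close>

lemma eta_Y_inverse_poly_top_coeff: "coeff (eta_Y_inverse_poly (Suc n)) (Suc n) = 5 ^ (2 * n + 1)"
proof (induction n)
  case (Suc n)
  have "coeff (eta_Y_inverse_poly (Suc (Suc n))) (Suc (Suc n)) = 25 * coeff (eta_Y_inverse_poly (Suc n)) (Suc n)"
  proof -
    consider "n = 0" | "n = 1" | "n = 2" | k where "n = Suc (Suc (Suc k))"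
      by (metis One_nat_def Suc_1 not0_implies_Suc)
    thus ?thesis
      by cases (simp_all add: eval_nat_numeral eta_Y_inverse_poly_coeff_eq_0)
  qed
  thus ?case using Suc by simp
qed simp

text \<open>The coefficient of \<open>e\<^sub>m\<close> in \<open>U e\<^sub>n\<close>.\<close>

definition hecke_mat :: "int \<Rightarrow> int \<Rightarrow> int \<Rightarrow> int" where
  "hecke_mat r n m =
     (if n \<ge> 0 then
        (if m \<ge> r - n \<and> 6 dvd m - (r - n) then coeff (eta_Y_poly (nat n)) (nat ((m - (r - n)) div 6)) else 0)
      else
        (if m \<le> r - n \<and> 6 dvd r - n - m then coeff (eta_Y_inverse_poly (nat (- n))) (nat ((r - n - m) div 6)) else 0))"

text \<open>Each power of \<open>eta_tau\<close> moves the index by 6. The bound comes from the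
  degree of \<open>eta_Y_poly\<close> for n >= 0, and from the order of vanishing of
  \<open>eta_Y_inverse_poly\<close> at 0 for n < 0.\<close>

lemma hecke_mat_neq_0_upper:
  assumes "hecke_mat r n m \<noteq> 0"
  shows "5 * (m - r) \<le> n"
proof (cases "n \<ge> 0")
  case True
  define i where "i = (m - (r - n)) div 6"
  have m: "m = r - n + 6 * i" "i \<ge> 0" "coeff (eta_Y_poly (nat n)) (nat i) \<noteq> 0"
    using assms True by (auto simp: hecke_mat_def i_def split: if_splits)
  have "5 * nat i \<le> nat n" using eta_Y_poly_coeff_eq_0 m(3) not_le by blast
  hence "int (5 * nat i) \<le> int (nat n)" by (simp only: of_nat_le_iff)
  hence "5 * i \<le> n" using m(2) True by simp
  thus ?thesis using m(1) by simp
next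
  case False
  define i where "i = (r - n - m) div 6"
  have m: "m = r - n - 6 * i" "i \<ge> 0" "coeff (eta_Y_inverse_poly (nat (- n))) (nat i) \<noteq> 0"
    using assms False by (auto simp: hecke_mat_def i_def split: if_splits)
  have "nat (- n) \<le> 5 * nat i" using eta_Y_inverse_poly_coeff_eq_0 m(3) not_le by blast
  hence "int (nat (- n)) \<le> int (5 * nat i)" by (simp only: of_nat_le_iff)
  hence "- n \<le> 5 * i" using m(2) False by simp
  thus ?thesis using m(1) by simp
qed

text \<open>For n >= 0 the lowest index belongs to the constant coefficient of
  \<open>eta_Y_poly\<close>, for n < 0 to the top degree of
  \<open>eta_Y_inverse_poly\<close>.\<close>

lemma hecke_mat_neq_0_lower:
  assumes "hecke_mat r n m \<noteq> 0"
  shows "m \<ge> (if n \<ge> 0 then r - n else r + 5 * n)"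
proof (cases "n \<ge> 0")
  case True
  thus ?thesis using assms by (auto simp: hecke_mat_def split: if_splits)
next
  case False
  define i where "i = (r - n - m) div 6"
  have m: "m = r - n - 6 * i" "i \<ge> 0" "coeff (eta_Y_inverse_poly (nat (- n))) (nat i) \<noteq> 0"
    using assms False by (auto simp: hecke_mat_def i_def split: if_splits)
  have "nat i \<le> nat (- n)" using eta_Y_inverse_poly_coeff_eq_0 m(3) not_le by blast
  hence "i \<le> - n" using m(2) False by (simp add: nat_le_eq_zle)
  thus ?thesis using m(1) False by simp
qed

lemma hecke_mat_lowest_pos: "n \<ge> 0 \<Longrightarrow> hecke_mat r n (r - n) = coeff (eta_Y_poly (nat n)) 0"
  by (simp add: hecke_mat_def)

lemma hecke_mat_lowest_neg:
  assumes "n < 0"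
  shows "hecke_mat r n (r + 5 * n) = 5 ^ nat (- 2 * n - 1)"
proof -
  obtain a where a: "n = - int (Suc a)"
    using assms by (metis zero_less_imp_eq_int neg_0_less_iff_less minus_minus gr0_implies_Suc of_nat_0_less_iff)
  have "hecke_mat r n (r + 5 * n) = coeff (eta_Y_inverse_poly (Suc a)) (Suc a)"
  proof -
    have "r - n - (r + 5 * n) = 6 * int (Suc a)" "nat (- n) = Suc a" using a by simp_all
    thus ?thesis using assms unfolding hecke_mat_def
      by (simp only: nonzero_mult_div_cancel_left dvd_triv_left nat_int) (simp add: a)
  qed
  also have "\<dots> = 5 ^ (2 * a + 1)" by (rule eta_Y_inverse_poly_top_coeff)
  also have "2 * a + 1 = nat (- 2 * n - 1)" by (simp add: a)
  finally show ?thesis .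
qed

lemma hecke_mat_highest: "k \<ge> 0 \<Longrightarrow> hecke_mat r (5 * k) (r + k) = 1"
  using eta_Y_poly_top_coeff[of "nat k"] by (simp add: hecke_mat_def nat_mult_distrib)

lemma sum_dvd_iff_single:
  fixes f :: "'a \<Rightarrow> int"
  assumes "finite I" "b \<in> I" "\<And>i. i \<in> I \<Longrightarrow> i \<noteq> b \<Longrightarrow> p dvd f i"
  shows "p dvd (\<Sum>i\<in>I. f i) \<longleftrightarrow> p dvd f b"
proof -
  have "p dvd (\<Sum>i\<in>I - {b}. f i)" using assms(3) by (intro dvd_sum) auto
  thus ?thesis unfolding sum.remove[OF assms(1,2)] by (simp add: dvd_add_left_iff)
qed

text \<open>The bounds say that \<open>\<eta>^n \<eta>\<^sub>5^(r - n)\<close> vanishes at both cusps of \<open>\<Gamma>\<^sub>0(5)\<close>.\<close>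

definition index_range :: "int \<Rightarrow> int set" where
  "index_range r = {n. - r < 4 * n \<and> 4 * n < 5 * r}"

lemma finite_index_range [simp]: "finite (index_range r)"
  by (rule finite_subset[of _ "{- \<bar>r\<bar>..2 * \<bar>r\<bar>}"]) (auto simp: index_range_def)

text \<open>The ends of the range are fixed by the bounds: n to r + n / 5 fixes 5 r / 4, n to r + 5
  n fixes - r / 4, and n to r - n sends 5 r / 4 to - r / 4.\<close>

lemma hecke_mat_index_range:
  assumes "hecke_mat r n m \<noteq> 0" "n \<in> index_range r"
  shows "m \<in> index_range r"
  using hecke_mat_neq_0_upper[OF assms(1)] hecke_mat_neq_0_lower[OF assms(1)] assms(2)
  unfolding index_range_def by (auto split: if_splits)

text \<open>Let \<open>b\<close> and \<open>l\<close> be the largest and the smallest index with a nonzero coefficient modulo \<open>p\<close>. If \<open>5 dvd b\<close>, then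
  the top index \<open>r + b / 5\<close> of the image receives a contribution from \<open>b\<close> only. Otherwise its lowest index
  is \<open>r - b\<close> or \<open>r + 5 l\<close>; these differ, so there is no cancellation.\<close>

lemma hecke_mat_injective:
  assumes p: "prime p" "p \<noteq> 5"
    and c: "\<And>m. m \<in> index_range r \<Longrightarrow> int p dvd (\<Sum>n\<in>index_range r. c n * hecke_mat r n m)"
    and n0: "n0 \<in> index_range r"
  shows "int p dvd c n0"
proof (rule ccontr)
  assume not_dvd: "\<not> int p dvd c n0"
  define I where "I = index_range r"
  define J where "J = {n \<in> I. \<not> int p dvd c n}"
  have J: "finite J" "J \<noteq> {}" using n0 not_dvd by (auto simp: J_def I_def)
  define b l where "b = Max J" and "l = Min J"
  have b: "b \<in> J" "\<And>n. n \<in> J \<Longrightarrow> n \<le> b" and l: "l \<in> J" "\<And>n. n \<in> J \<Longrightarrow> l \<le> n"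
    using J by (simp_all add: b_def l_def)
  have prime: "prime (int p)" using p by simp
  have p5: "\<not> int p dvd 5 ^ e" for e
  proof
    assume "int p dvd 5 ^ e"
    hence "int p dvd 5" using prime prime_dvd_power by blast
    hence "p dvd 5" by presburger
    moreover have "prime (5::nat)" by simp
    ultimately show False using p primes_dvd_imp_eq by blast
  qed
  \<comment> \<open>A position \<open>m\<close> that only one index of the support \<open>J\<close>
    reaches, by an entry prime to \<open>p\<close>, contradicts the assumption on the image.\<close>
  have single: False
    if "n \<in> J" "\<not> int p dvd hecke_mat r n m"
      "\<And>k. k \<in> J \<Longrightarrow> k \<noteq> n \<Longrightarrow> hecke_mat r k m = 0" for n m
  proof -
    have "m \<in> index_range r"
      by (rule hecke_mat_index_range[of r n]) (use that in \<open>auto simp: J_def I_def\<close>)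
    hence "int p dvd (\<Sum>k\<in>I. c k * hecke_mat r k m)" using c by (simp add: I_def)
    also have "?this \<longleftrightarrow> int p dvd c n * hecke_mat r n m"
    proof (rule sum_dvd_iff_single)
      fix k assume "k \<in> I" "k \<noteq> n"
      thus "int p dvd c k * hecke_mat r k m" using that(3)[of k] by (cases "k \<in> J") (auto simp: J_def)
    qed (use that in \<open>auto simp: J_def I_def\<close>)
    finally show False using that prime by (auto simp: J_def prime_dvd_mult_iff)
  qed
  have zero_upper: "hecke_mat r k m = 0" if "5 * (m - r) > k" for k m
    using hecke_mat_neq_0_upper[of r k m] that by linarith
  have zero_lower: "hecke_mat r k m = 0" if "m < (if k \<ge> 0 then r - k else r + 5 * k)" for k m
    using hecke_mat_neq_0_lower[of r k m] that by linarith
  have neg: False if "l < 0" "r + 5 * l < r - b \<or> b < 0"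
  proof (rule single[of l "r + 5 * l"])
    show "\<not> int p dvd hecke_mat r l (r + 5 * l)"
      unfolding hecke_mat_lowest_neg[OF that(1)] by (rule p5)
    show "hecke_mat r k (r + 5 * l) = 0" if "k \<in> J" "k \<noteq> l" for k
      by (rule zero_lower) (use that \<open>r + 5 * l < r - b \<or> b < 0\<close> b(2)[of k] l(2)[of k] in auto)
  qed (fact l)
  \<comment> \<open>If the two candidates for the lowest index agreed, then b = - 5 l would be a
    multiple of 5.\<close>
  consider "b < 0" | k where "b = 5 * k" "k \<ge> 0" | "b \<ge> 0" "\<not> 5 dvd b" "r + 5 * l < r - b"
    | "b \<ge> 0" "\<not> 5 dvd b" "r + 5 * l > r - b"
  proof -
    have "5 dvd b" if "r + 5 * l = r - b"
    proof -
      have "b = 5 * (- l)" using that by simp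
      thus ?thesis by (rule dvdI)
    qed
    thus thesis using that by (cases "b < 0"; cases "5 dvd b"; force simp: not_less elim!: dvdE)
  qed
  thus False
  proof cases
    case 1
    thus False using neg l(2)[OF b(1)] by simp
  next
    case (2 k)
    show False
    proof (rule single[OF b(1), of "r + k"])
      show "\<not> int p dvd hecke_mat r b (r + k)"
        using p5[of 0] 2 hecke_mat_highest by simp
      show "hecke_mat r n (r + k) = 0" if "n \<in> J" "n \<noteq> b" for n
        by (rule zero_upper) (use that b(2)[of n] 2 in simp)
    qed
  next
    case 3
    thus False using neg by linarith
  next
    case 4
    show False
    proof (rule single[OF b(1), of "r - b"])
      have "\<not> 5 dvd nat b" using 4 by presburger
      thus "\<not> int p dvd hecke_mat r b (r - b)"
        unfolding hecke_mat_lowest_pos[OF 4(1)] using eta_Y_poly_coeff_0_not_dvd p by blast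
      show "hecke_mat r n (r - b) = 0" if "n \<in> J" "n \<noteq> b" for n
        by (rule zero_lower) (use that b(2)[of n] l(2)[of n] 4 in auto)
    qed
  qed
qed

subsection \<open>Vanishing coefficients of eta powers\<close>

text \<open>By the pigeonhole principle two iterates of \<open>T\<close> agree modulo
  \<open>p\<close>, and injectivity cancels the steps that they share.\<close>

lemma linear_map_mod_returns:
  fixes M :: "'i \<Rightarrow> 'i \<Rightarrow> int" and c :: "'i \<Rightarrow> int" and p :: int and I :: "'i set"
  defines "T \<equiv> \<lambda>c j. \<Sum>i\<in>I. c i * M i j"
  assumes "finite I" "p > 0"
    and inj: "\<And>c i. (\<And>j. j \<in> I \<Longrightarrow> p dvd T c j) \<Longrightarrow> i \<in> I \<Longrightarrow> p dvd c i"
  shows "\<exists>N. \<forall>i\<in>I. p dvd (T ^^ Suc N) c i - c i"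
proof -
  \<comment> \<open>Restricting to \<open>I\<close> and reducing modulo \<open>p\<close> makes the
    iterates elements of a finite set.\<close>
  define f where "f k = restrict (\<lambda>i. (T ^^ k) c i mod p) I" for k
  have "range f \<subseteq> PiE I (\<lambda>_. {0..<p})"
    using \<open>p > 0\<close> by (auto simp: f_def)
  moreover have "finite (PiE I (\<lambda>_. {0..<p}))"
    using \<open>finite I\<close> by (intro finite_PiE) auto
  ultimately have "finite (range f)" by (rule finite_subset)
  hence "\<not> inj f" using finite_imageD infinite_UNIV_nat by blast
  then obtain k l where "f k = f l" "k \<noteq> l" by (auto simp: inj_def)
  then obtain k l where kl: "f k = f l" "k < l" by (metis linorder_neqE_nat)
  define N where "N = l - k - 1"
  have cancel: "\<forall>i\<in>I. p dvd a i - b i" if "\<forall>i\<in>I. p dvd (T ^^ n) a i - (T ^^ n) b i" for n a b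
    using that
  proof (induction n)
    case (Suc n)
    define x y where "x = (T ^^ n) a" and "y = (T ^^ n) b"
    have "p dvd x i - y i" if "i \<in> I" for i
    proof (rule inj[OF _ that])
      fix j assume "j \<in> I"
      hence "p dvd T x j - T y j" using Suc.prems by (simp add: x_def y_def)
      also have "T x j - T y j = T (\<lambda>i. x i - y i) j"
        by (simp add: T_def left_diff_distrib sum_subtractf)
      finally show "p dvd T (\<lambda>i. x i - y i) j" .
    qed
    thus ?case using Suc.IH by (simp add: x_def y_def)
  qed simp
  have "\<forall>i\<in>I. p dvd (T ^^ k) ((T ^^ Suc N) c) i - (T ^^ k) c i"
  proof
    fix i assume "i \<in> I"
    have "(T ^^ k) ((T ^^ Suc N) c) = (T ^^ (k + Suc N)) c"
      by (simp only: funpow_add o_apply)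
    also have "k + Suc N = l" using kl by (simp add: N_def)
    finally have "(T ^^ k) ((T ^^ Suc N) c) i = (T ^^ l) c i" by simp
    moreover have "(T ^^ l) c i mod p = (T ^^ k) c i mod p"
      using fun_cong[OF kl(1), of i] \<open>i \<in> I\<close> by (simp add: f_def)
    ultimately show "p dvd (T ^^ k) ((T ^^ Suc N) c) i - (T ^^ k) c i"
      by (simp add: mod_eq_dvd_iff)
  qed
  thus ?thesis using cancel by blast
qed

section \<open>The action of U on eta quotients\<close>

definition eta_quot :: "int \<Rightarrow> int \<Rightarrow> complex fls" where
  "eta_quot r n = eta powi n * eta5 powi (r - n)"

lemma eta_quot_shift:
  "eta_quot r n * eta_tau ^ i = eta_quot r (n + 6 * int i)"
  "eta_quot r n * inverse eta_tau ^ i = eta_quot r (n - 6 * int i)"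
proof -
  have tau: "eta_tau ^ i = eta powi (6 * int i) * eta5 powi (- (6 * int i))"
  proof -
    have "eta_tau ^ i = eta ^ (6 * i) / eta5 ^ (6 * i)"
      by (simp add: eta_tau_def power_divide flip: power_mult)
    also have "\<dots> = eta powi int (6 * i) * eta5 powi (- int (6 * i))"
      by (simp only: power_int_of_nat power_int_minus divide_inverse)
    finally show ?thesis by simp
  qed
  have itau: "inverse eta_tau ^ i = eta powi (- (6 * int i)) * eta5 powi (6 * int i)"
    by (simp only: power_inverse tau power_int_minus inverse_mult_distrib inverse_inverse_eq)
  have shift: "eta_quot r n * (eta powi k * eta5 powi (- k)) = eta_quot r (n + k)" for k
  proof -
    have "eta powi (n + k) = eta powi n * eta powi k" "eta5 powi (r - n + - k) = eta5 powi (r - n) * eta5 powi (- k)"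
      by (rule power_int_add; simp)+
    moreover have "r - (n + k) = r - n + - k" by simp
    ultimately show ?thesis by (simp only: eta_quot_def mult_ac)
  qed
  show "eta_quot r n * eta_tau ^ i = eta_quot r (n + 6 * int i)"
    unfolding tau by (rule shift)
  show "eta_quot r n * inverse eta_tau ^ i = eta_quot r (n - 6 * int i)"
    using shift[of "- (6 * int i)"] by (simp only: itau minus_minus diff_conv_add_uminus)
qed

text \<open>The dilated factor is \<open>\<eta>\<^sub>5^(r - n) \<eta>\<^sub>2\<^sub>5^n\<close>.
  Pulling it out by the projection formula reduces \<open>U\<close> on eta quotients to powers of
  \<open>eta_Y\<close>.\<close>

lemma eta_quot_eq_dilate:
  "eta_quot r n = dilate (eta_quot r (r - n)) * eta_Y powi n"
proof -
  have "dilate (eta_quot r (r - n)) = eta5 powi (r - n) * eta25 powi n"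
    by (simp add: eta_quot_def dilate_power_int flip: eta5_def eta25_def)
  thus ?thesis by (simp add: eta_quot_def eta_Y_def power_int_divide_distrib)
qed

lemma decimate_eta_quot:
  assumes "n \<in> index_range r"
  shows "decimate (eta_quot r n) = (\<Sum>m\<in>index_range r. of_int (hecke_mat r n m) * eta_quot r m)"
proof (cases "n \<ge> 0")
  case True
  define A where "A = (\<lambda>i. r - n + 6 * int i) ` {..nat n}"
  have "eta_Y powi n = eta_Y ^ nat n" using True by (simp add: power_int_def)
  hence "decimate (eta_quot r n) = eta_quot r (r - n) * int_poly_eval (eta_Y_poly (nat n)) eta_tau"
    by (subst eta_quot_eq_dilate) (simp only: decimate_dilate_mult decimate_eta_Y_power)
  also have "\<dots> = (\<Sum>i\<le>nat n. of_int (coeff (eta_Y_poly (nat n)) i) * (eta_quot r (r - n) * eta_tau ^ i))"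
    by (subst int_poly_eval_eq_sum[of "nat n"])
       (auto simp: eta_Y_poly_coeff_eq_0 sum_distrib_left mult_ac)
  also have "\<dots> = (\<Sum>i\<le>nat n. of_int (hecke_mat r n (r - n + 6 * int i)) * eta_quot r (r - n + 6 * int i))"
    unfolding eta_quot_shift using True by (simp add: hecke_mat_def)
  also have "\<dots> = (\<Sum>m\<in>A. of_int (hecke_mat r n m) * eta_quot r m)"
    unfolding A_def by (subst sum.reindex) (auto simp: inj_on_def)
  \<comment> \<open>The sums over \<open>A\<close> and over the index range agree, since the matrix
    entries vanish on either difference.\<close>
  also have "\<dots> = (\<Sum>m\<in>index_range r. of_int (hecke_mat r n m) * eta_quot r m)"
  proof (rule sum.mono_neutral_cong)
    show "of_int (hecke_mat r n m) * eta_quot r m = 0" if "m \<in> A - index_range r" for m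
      using hecke_mat_index_range[of r n m] assms that by auto
    show "of_int (hecke_mat r n m) * eta_quot r m = 0" if m: "m \<in> index_range r - A" for m
    proof (rule ccontr)
      assume "of_int (hecke_mat r n m) * eta_quot r m \<noteq> 0"
      hence nz: "hecke_mat r n m \<noteq> 0" by auto
      define i where "i = (m - (r - n)) div 6"
      have i: "m = r - n + 6 * i" "i \<ge> 0"
        using nz True by (auto simp: hecke_mat_def i_def split: if_splits)
      moreover have "i \<le> n"
        using hecke_mat_neq_0_upper[OF nz] i True by simp
      ultimately have "m = r - n + 6 * int (nat i)" "nat i \<in> {..nat n}" by auto
      hence "m \<in> A" unfolding A_def by (rule image_eqI)
      thus False using m by simp
    qed
  qed (simp_all add: A_def)
  finally show ?thesis .
next
  case False
  define a where "a = nat (- n)"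
  define A where "A = (\<lambda>i. r - n - 6 * int i) ` {..a}"
  have "eta_Y powi n = inverse eta_Y ^ a" using False by (simp add: power_int_def a_def)
  hence "decimate (eta_quot r n) = eta_quot r (r - n) * int_poly_eval (eta_Y_inverse_poly a) (inverse eta_tau)"
    by (subst eta_quot_eq_dilate) (simp only: decimate_dilate_mult decimate_eta_Y_inverse_power)
  also have "\<dots> = (\<Sum>i\<le>a. of_int (coeff (eta_Y_inverse_poly a) i) * (eta_quot r (r - n) * inverse eta_tau ^ i))"
    by (subst int_poly_eval_eq_sum[of a])
       (auto simp: eta_Y_inverse_poly_coeff_eq_0 sum_distrib_left mult_ac)
  also have "\<dots> = (\<Sum>i\<le>a. of_int (hecke_mat r n (r - n - 6 * int i)) * eta_quot r (r - n - 6 * int i))"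
    unfolding eta_quot_shift using False by (simp add: hecke_mat_def a_def)
  also have "\<dots> = (\<Sum>m\<in>A. of_int (hecke_mat r n m) * eta_quot r m)"
    unfolding A_def by (subst sum.reindex) (auto simp: inj_on_def)
  also have "\<dots> = (\<Sum>m\<in>index_range r. of_int (hecke_mat r n m) * eta_quot r m)"
  proof (rule sum.mono_neutral_cong)
    show "of_int (hecke_mat r n m) * eta_quot r m = 0" if "m \<in> A - index_range r" for m
      using hecke_mat_index_range[of r n m] assms that by auto
    show "of_int (hecke_mat r n m) * eta_quot r m = 0" if m: "m \<in> index_range r - A" for m
    proof (rule ccontr)
      assume "of_int (hecke_mat r n m) * eta_quot r m \<noteq> 0"
      hence nz: "hecke_mat r n m \<noteq> 0" by auto
      define i where "i = (r - n - m) div 6"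
      have i: "m = r - n - 6 * i" "i \<ge> 0"
        using nz False by (auto simp: hecke_mat_def i_def split: if_splits)
      moreover have "i \<le> - n"
        using hecke_mat_neq_0_lower[OF nz] i False by simp
      ultimately have "m = r - n - 6 * int (nat i)" "nat i \<in> {..a}" by (auto simp: a_def)
      hence "m \<in> A" unfolding A_def by (rule image_eqI)
      thus False using m by simp
    qed
  qed (simp_all add: A_def)
  finally show ?thesis .
qed

text \<open>Over the complex numbers divisibility by \<open>p\<close> is vacuous; a congruence is
  expressed as \<open>p\<close> times a series from this set.\<close>

definition fls_Ints :: "'a::ring_1 fls set" where
  "fls_Ints = {f. \<forall>n. f $$ n \<in> \<int>}"

lemma fls_Ints_mult: "f \<in> fls_Ints \<Longrightarrow> g \<in> fls_Ints \<Longrightarrow> f * g \<in> fls_Ints"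
  unfolding fls_Ints_def mem_Collect_eq fls_times_nth(1) by (blast intro: Ints_sum Ints_mult)

lemma fls_Ints_power: "f \<in> fls_Ints \<Longrightarrow> f ^ n \<in> fls_Ints"
proof (induction n)
  case 0
  show ?case by (simp add: fls_Ints_def)
qed (auto intro: fls_Ints_mult)

lemma fls_Ints_dilate: "f \<in> fls_Ints \<Longrightarrow> dilate f \<in> fls_Ints"
  by (auto simp: fls_Ints_def fls_nth_compose_power)

lemma fls_Ints_of_int_fps: "fps_to_fls (of_int_fps f) \<in> fls_Ints"
  by (auto simp: fls_Ints_def)

lemma euler_unit: "\<exists>k. k * euler = 1"
  by (rule exI, rule fps_left_inverse[of 1]) simp

text \<open>\<open>eta\<close> is X times an integer series with constant term 1, which is a unit
  over the integers.\<close>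

lemma inverse_eta_in_fls_Ints: "inverse eta \<in> fls_Ints"
proof -
  obtain k where k: "k * euler = 1" using euler_unit by blast
  define k' where "k' = (of_int_fps (k oo fps_X ^ 24) :: complex fps)"
  have "(k oo fps_X ^ 24) * (euler oo fps_X ^ 24) = 1"
    by (subst fps_compose_mult_distrib[symmetric]) (simp_all add: k)
  hence "k' * of_int_fps (euler oo fps_X ^ 24) = 1"
    unfolding k'_def of_int_fps_mult[symmetric] by simp
  hence "fps_to_fls k' * fps_to_fls (of_int_fps (euler oo fps_X ^ 24)) = 1"
    unfolding fls_times_fps_to_fls[symmetric] by simp
  hence "eta * (fls_X_inv * fps_to_fls k') = fls_X * fls_X_inv"
    by (simp add: eta_def theta_eq_euler of_int_fps_mult fls_times_fps_to_fls mult_ac)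
  also have "fls_X * fls_X_inv = (1 :: complex fls)"
    by (simp add: fls_X_inv_times_conv_shift fls_X_conv_shift_1)
  finally have "inverse eta = fls_X_inv * fps_to_fls k'"
    by (rule inverse_unique)
  also have "\<dots> \<in> fls_Ints"
    by (auto simp: fls_Ints_def fls_X_inv_times_conv_shift k'_def)
  finally show ?thesis .
qed

lemma eta_quot_in_fls_Ints: "eta_quot r n \<in> fls_Ints"
proof -
  have eta: "eta powi k \<in> fls_Ints" for k
  proof -
    have "eta \<in> fls_Ints" unfolding eta_def by (rule fls_Ints_of_int_fps)
    thus ?thesis using inverse_eta_in_fls_Ints by (auto simp: power_int_def intro: fls_Ints_power)
  qed
  have "eta5 powi k \<in> fls_Ints" for k
    using fls_Ints_dilate[OF eta[of k]] by (simp add: dilate_power_int flip: eta5_def)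
  thus ?thesis unfolding eta_quot_def using eta by (intro fls_Ints_mult)
qed

lemma decimate_funpow_nth: "(decimate ^^ k) f $$ n = f $$ (5 ^ k * n)"
  by (induction k arbitrary: n) (simp_all add: mult_ac)

lemma fls_of_int_mult_nth: "(of_int c * f) $$ n = of_int c * f $$ n"
  by (simp add: fls_of_int)

lemma int_dvd_if_Ints:
  assumes "of_int x = of_int p * (z :: complex)" "z \<in> \<int>"
  shows "p dvd x"
proof -
  obtain y where "z = of_int y" using assms(2) by (auto elim: Ints_cases)
  hence "(of_int x :: complex) = of_int (p * y)" using assms(1) by simp
  hence "x = p * y" by (simp only: of_int_eq_iff)
  thus ?thesis by simp
qed

theorem theta_power_vanishing:
  assumes p: "prime p" "p \<noteq> 5" and r: "r \<ge> 1"
  shows "\<exists>k. \<forall>j. \<not> 5 dvd j \<longrightarrow> int p dvd (theta ^ r) $ (5 ^ k * j)"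
proof -
  define I where "I = index_range (int r)"
  define M where "M = hecke_mat (int r)"
  define T where "T = (\<lambda>c j. \<Sum>i\<in>I. c i * M i j)"
  \<comment> \<open>The coordinates of \<open>e\<^sub>0 = \<eta>\<^sub>5^r\<close>; \<open>T\<close>
    is the action of \<open>U\<close> on coordinates.\<close>
  define c0 :: "int \<Rightarrow> int" where "c0 n = (if n = 0 then 1 else 0)" for n
  define g :: "(int \<Rightarrow> int) \<Rightarrow> complex fls" where "g c = (\<Sum>n\<in>I. of_int (c n) * eta_quot (int r) n)" for c
  have fin: "finite I" by (simp add: I_def)
  have "\<exists>N. \<forall>i\<in>I. int p dvd (T ^^ Suc N) c0 i - c0 i"
    unfolding T_def
  proof (rule linear_map_mod_returns[OF fin])
    show "0 < int p" using p by (simp add: prime_gt_0_nat)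
    show "int p dvd c i" if "\<And>j. j \<in> I \<Longrightarrow> int p dvd (\<Sum>i\<in>I. c i * M i j)" "i \<in> I" for c i
      using hecke_mat_injective[OF p, of "int r" c i] that by (simp add: I_def M_def)
  qed
  then obtain N where N: "\<And>i. i \<in> I \<Longrightarrow> int p dvd (T ^^ Suc N) c0 i - c0 i" by blast
  have "decimate (g c) = g (T c)" for c
  proof -
    have "decimate (g c) = (\<Sum>n\<in>I. of_int (c n) * (\<Sum>m\<in>I. of_int (M n m) * eta_quot (int r) m))"
      by (simp add: g_def decimate_sum decimate_of_int_mult decimate_eta_quot I_def M_def)
    also have "\<dots> = (\<Sum>m\<in>I. \<Sum>n\<in>I. of_int (c n) * of_int (M n m) * eta_quot (int r) m)"
      unfolding sum_distrib_left by (subst sum.swap) (simp add: mult_ac)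
    also have "\<dots> = g (T c)"
      by (simp add: g_def T_def sum_distrib_right)
    finally show ?thesis .
  qed
  hence iter: "(decimate ^^ k) (g c) = g ((T ^^ k) c)" for k c
    by (induction k) simp_all
  have "0 \<in> I" using r by (simp add: I_def index_range_def)
  have g0: "g c0 = eta5 ^ r"
  proof -
    have "g c0 = (\<Sum>n\<in>I. if n = 0 then eta_quot (int r) 0 else 0)"
      unfolding g_def by (rule sum.cong) (auto simp: c0_def)
    thus ?thesis using fin \<open>0 \<in> I\<close> by (simp add: eta_quot_def)
  qed
  \<comment> \<open>The division is exact on \<open>I\<close>, so \<open>h\<close> has integer
    coefficients.\<close>
  define d where "d n = ((T ^^ Suc N) c0 n - c0 n) div int p" for n
  define h where "h = (\<Sum>n\<in>I. of_int (d n) * eta_quot (int r) n)"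
  have "(decimate ^^ Suc N) (eta5 ^ r) - eta5 ^ r = (\<Sum>n\<in>I. of_int ((T ^^ Suc N) c0 n - c0 n) * eta_quot (int r) n)"
    unfolding g0[symmetric] iter by (simp add: g_def sum_subtractf left_diff_distrib)
  also have "\<dots> = (\<Sum>n\<in>I. of_int (int p * d n) * eta_quot (int r) n)"
    by (rule sum.cong) (use N in \<open>simp_all add: d_def del: funpow.simps\<close>)
  also have "\<dots> = of_int (int p) * h"
    by (simp add: h_def sum_distrib_left mult_ac)
  finally have main: "(decimate ^^ Suc N) (eta5 ^ r) - eta5 ^ r = of_int (int p) * h" .
  have "h \<in> fls_Ints"
    using eta_quot_in_fls_Ints by (auto simp: h_def fls_Ints_def fls_nth_sum fls_of_int intro!: Ints_sum Ints_mult)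
  have "decimate (eta5 ^ r) = eta ^ r"
    using decimate_dilate_mult[of "eta ^ r" 1] by (simp flip: eta5_def)
  hence "(decimate ^^ N) (eta ^ r) - eta5 ^ r = of_int (int p) * h"
    using main by (simp only: funpow_Suc_right o_apply)
  show ?thesis
  proof (intro exI allI impI)
    fix j :: nat assume j: "\<not> 5 dvd j"
    \<comment> \<open>\<open>eta5 ^ r\<close> is a series in X^5, so only the multiple of
      \<open>p\<close> remains at exponents prime to 5.\<close>
    have "dilate (eta ^ r) $$ int j = 0" using j by (intro fls_nth_compose_power'(1)) simp
    hence "(eta5 ^ r) $$ int j = 0" by (simp flip: eta5_def)
    moreover have "(eta ^ r) $$ (5 ^ N * int j) = of_int ((theta ^ r) $ (5 ^ N * j))"
    proof -
      have "eta ^ r = fps_to_fls (of_int_fps (theta ^ r))"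
        by (simp add: eta_def of_int_fps_power fps_to_fls_power)
      hence "(eta ^ r) $$ int (5 ^ N * j) = of_int ((theta ^ r) $ (5 ^ N * j))"
        by (simp only: fps_to_fls_nth of_int_fps_nth nat_int of_nat_less_0_iff if_False)
      thus ?thesis by simp
    qed
    ultimately have "of_int ((theta ^ r) $ (5 ^ N * j)) = of_int (int p) * h $$ int j"
      using arg_cong[OF \<open>(decimate ^^ N) (eta ^ r) - eta5 ^ r = of_int (int p) * h\<close>, of "\<lambda>f. f $$ int j"]
      by (simp add: decimate_funpow_nth fls_of_int)
    moreover have "h $$ int j \<in> \<int>" using \<open>h \<in> fls_Ints\<close> by (simp add: fls_Ints_def)
    ultimately show "int p dvd (theta ^ r) $ (5 ^ N * j)" by (rule int_dvd_if_Ints)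
  qed
qed

text \<open>The product \<open>\<eta>^4 \<eta>\<^sub>5^w\<close> is a dilated series times
  \<open>eta_Y ^ 4\<close>, so the factor - 5 of \<open>decimate_eta_Y4\<close> appears.\<close>

lemma theta_power_4_mult_vanishing:
  "5 dvd (theta ^ 4 * (theta oo fps_X ^ 5) ^ w) $ (5 * j)"
proof -
  have eta5: "eta5 = fps_to_fls (of_int_fps (theta oo fps_X ^ 5))"
    by (simp add: eta5_def eta_def fls_compose_power_fps_to_fls of_int_fps_compose_X_power)
  define f where "f = theta ^ 4 * (theta oo fps_X ^ 5) ^ w"
  have f: "fps_to_fls (of_int_fps f) = eta ^ 4 * eta5 ^ w"
    unfolding f_def eta5 eta_def of_int_fps_mult of_int_fps_power fls_times_fps_to_fls fps_to_fls_power ..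
  have "dilate (eta5 ^ 4 * eta ^ w) = eta25 ^ 4 * eta5 ^ w"
    by (simp flip: eta5_def eta25_def)
  hence "eta ^ 4 * eta5 ^ w = dilate (eta5 ^ 4 * eta ^ w) * eta_Y ^ 4"
    by (simp only: eta_Y_def) (simp add: power_divide)
  hence dec: "decimate (eta ^ 4 * eta5 ^ w) = of_int (- 5) * (eta5 ^ 4 * eta ^ w)"
    by (simp only: decimate_dilate_mult decimate_eta_Y4) (simp add: mult.commute)
  have "of_int (f $ (5 * j)) = fps_to_fls (of_int_fps f) $$ int (5 * j)"
    by (simp only: fps_to_fls_nth of_int_fps_nth nat_int of_nat_less_0_iff if_False)
  also have "\<dots> = decimate (fps_to_fls (of_int_fps f)) $$ int j"
    by (simp only: decimate_nth of_nat_mult of_nat_numeral)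
  also have "\<dots> = of_int (- 5) * (eta5 ^ 4 * eta ^ w) $$ int j"
    by (simp only: f dec fls_of_int_mult_nth)
  finally have "of_int (f $ (5 * j)) = of_int (- 5) * (eta5 ^ 4 * eta ^ w) $$ int j" .
  moreover have "(eta5 ^ 4 * eta ^ w) $$ int j \<in> \<int>"
  proof -
    have "eta5 ^ 4 * eta ^ w \<in> fls_Ints"
      unfolding eta5 eta_def by (intro fls_Ints_mult fls_Ints_power fls_Ints_of_int_fps)
    thus ?thesis by (simp add: fls_Ints_def)
  qed
  ultimately have "- 5 dvd f $ (5 * j)"
    by (rule int_dvd_if_Ints)
  thus ?thesis by (simp add: f_def)
qed

subsection \<open>Regular partitions\<close>

lemma of_nat_dvd_int_fps_iff: "of_nat p dvd (f :: int fps) \<longleftrightarrow> (\<forall>n. int p dvd f $ n)"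
proof
  assume "of_nat p dvd f"
  then obtain g where "f = of_nat p * g" by (elim dvdE)
  thus "\<forall>n. int p dvd f $ n" by (simp add: fps_of_nat[symmetric])
next
  assume *: "\<forall>n. int p dvd f $ n"
  have "f = of_nat p * Abs_fps (\<lambda>n. f $ n div int p)"
    by (rule fps_ext) (use * in \<open>simp add: fps_of_nat[symmetric]\<close>)
  thus "of_nat p dvd f" by (rule dvdI)
qed

lemma of_nat_dvd_compose_X_power:
  fixes f :: "int fps"
  shows "of_nat p dvd f \<Longrightarrow> of_nat p dvd f oo fps_X ^ d"
  by (simp add: of_nat_dvd_int_fps_iff fps_nth_compose_X_power)

lemma prime_dvd_one_minus_power:
  fixes y :: "'a::comm_ring_1"
  assumes "prime p"
  shows "of_nat p dvd (1 - y) ^ p - (1 - y ^ p)"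
proof -
  have "p > 0" using assms by (simp add: prime_gt_0_nat)
  have "(1 - y) ^ p = (\<Sum>k\<le>p. of_nat (p choose k) * (- y) ^ k)"
    using binomial_ring[of "- y" 1 p] by simp
  also have "{..p} = insert 0 (insert p {0<..<p})" using \<open>p > 0\<close> by auto
  also have "(\<Sum>k\<in>\<dots>. of_nat (p choose k) * (- y) ^ k)
      = 1 + (- y) ^ p + (\<Sum>k\<in>{0<..<p}. of_nat (p choose k) * (- y) ^ k)"
    using \<open>p > 0\<close> by (simp add: add.assoc)
  finally have eq: "(1 - y) ^ p - (1 - y ^ p) = (y ^ p + (- y) ^ p)
      + (\<Sum>k\<in>{0<..<p}. of_nat (p choose k) * (- y) ^ k)"
    by (simp add: algebra_simps)
  \<comment> \<open>For odd \<open>p\<close> the sum is 0, for p = 2 it is 2 y^2.\<close>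
  have "of_nat p dvd y ^ p + (- y) ^ p"
  proof (cases "p = 2")
    case False
    hence "odd p" using assms prime_odd_nat prime_ge_2_nat le_neq_implies_less by metis
    thus ?thesis by simp
  qed simp
  moreover have "of_nat p dvd (\<Sum>k\<in>{0<..<p}. of_nat (p choose k) * (- y) ^ k)"
  proof (rule dvd_sum)
    fix k assume "k \<in> {0<..<p}"
    hence "p dvd p choose k" using assms by (intro dvd_choose_prime) auto
    then obtain c where "p choose k = p * c" by auto
    thus "of_nat p dvd of_nat (p choose k) * (- y) ^ k" by simp
  qed
  ultimately show ?thesis unfolding eq by (rule dvd_add)
qed

text \<open>The congruence (1 - y)^p = 1 - y^p modulo \<open>p\<close> is applied to each factor of
  a truncated product.\<close>

lemma euler_prime_cong:
  assumes "prime p"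
  shows "of_nat p dvd (euler oo fps_X ^ p) - euler ^ p"
  unfolding of_nat_dvd_int_fps_iff
proof
  fix n
  define P where "P = (\<Prod>k=1..n. 1 - fps_X ^ k :: int fps)"
  define Q where "Q = (\<Prod>k=1..n. 1 - fps_X ^ (p * k) :: int fps)"
  have p0: "p > 0" using assms by (simp add: prime_gt_0_nat)
  have "of_int_fps euler = euler"
    by (rule fps_ext) simp
  hence "fps_X ^ Suc n dvd (euler oo fps_X ^ p) - Q"
    using euler_compose_cong[OF p0, of n, where 'a = int] by (simp add: Q_def)
  moreover have "fps_X ^ Suc n dvd euler ^ p - P ^ p"
    unfolding P_def by (intro dvd_diff_power euler_cong)
  moreover have "of_nat p dvd P ^ p - Q"
    unfolding P_def Q_def prod_power_distrib
    by (rule dvd_diff_prod)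
       (use prime_dvd_one_minus_power[OF assms] in \<open>simp add: mult.commute[of p] power_mult\<close>)
  ultimately have "(euler oo fps_X ^ p) $ n = Q $ n" "(euler ^ p) $ n = (P ^ p) $ n"
      "int p dvd (P ^ p) $ n - Q $ n"
    unfolding fps_X_power_dvd_iff of_nat_dvd_int_fps_iff by auto
  thus "int p dvd ((euler oo fps_X ^ p) - euler ^ p) $ n"
    by (simp add: dvd_diff_commute)
qed

lemma euler_prime_power_cong:
  assumes "prime p"
  shows "of_nat p dvd (euler oo fps_X ^ (p ^ t)) - euler ^ (p ^ t)"
proof (induction t)
  case (Suc t)
  have p: "p > 0" "p ^ t > 0" using assms by (simp_all add: prime_gt_0_nat)
  have "(euler oo fps_X ^ (p ^ Suc t)) = (euler oo fps_X ^ p) oo fps_X ^ (p ^ t)"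
    using p by (simp add: fps_compose_assoc[symmetric] fps_X_power_compose mult.commute flip: power_mult)
  hence "of_nat p dvd (euler oo fps_X ^ (p ^ Suc t)) - (euler ^ p oo fps_X ^ (p ^ t))"
    using of_nat_dvd_compose_X_power[OF euler_prime_cong[OF assms], of "p ^ t"]
    by (simp add: fps_compose_sub_distrib)
  moreover have "euler ^ p oo fps_X ^ (p ^ t) = (euler oo fps_X ^ (p ^ t)) ^ p"
    by (rule fps_compose_power[symmetric]) (use p in simp)
  moreover have "of_nat p dvd (euler oo fps_X ^ (p ^ t)) ^ p - (euler ^ (p ^ t)) ^ p"
    by (rule dvd_diff_power) fact
  ultimately have "of_nat p dvd ((euler oo fps_X ^ (p ^ Suc t)) - (euler oo fps_X ^ (p ^ t)) ^ p)
      + ((euler oo fps_X ^ (p ^ t)) ^ p - (euler ^ (p ^ t)) ^ p)"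
    by (metis dvd_add)
  thus ?case by (simp add: mult.commute flip: power_mult)
qed simp

text \<open>Multiplying by the denominators avoids dividing infinite products. In the X-adic
  topology each coefficient of the partial products is eventually constant, so a finite truncation
  decides each coefficient.\<close>

lemma d_coeff_mult_euler:
  assumes "m \<ge> 1"
  shows "Abs_fps (d_coeff m) * euler = euler oo fps_X ^ m"
proof -
  define D where "D = (of_int_fps (Abs_fps (d_coeff m)) :: rat fps)"
  define E where "E = (of_int_fps euler :: rat fps)"
  define fac where "fac k = ((1 - fps_X ^ (m * Suc k)) / (1 - fps_X ^ Suc k) :: rat fps)" for k
  have "fac has_prod D"
    using d_coeff_generating_function[OF assms] by (simp add: fac_def[abs_def] D_def of_int_fps_def)
  hence "(\<lambda>n. \<Prod>k<n. fac k) \<longlonglongrightarrow> D"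
    by (rule has_prod_imp_tendsto')
  hence ev: "\<forall>\<^sub>F n in sequentially. (\<Prod>k<n. fac k) $ i = D $ i" for i
    unfolding tendsto_fps_iff by blast
  have fac: "fac k * (1 - fps_X ^ Suc k) = 1 - fps_X ^ (m * Suc k)" for k
  proof -
    have "(1 - fps_X ^ (m * Suc k) :: rat fps) = (1 - fps_X ^ Suc k) * (\<Sum>j<m. (fps_X ^ Suc k) ^ j)"
      by (simp only: power_mult mult.commute[of m] one_diff_power_eq)
    moreover have "(1 - fps_X ^ Suc k :: rat fps) \<noteq> 0"
    proof
      assume "(1 - fps_X ^ Suc k :: rat fps) = 0"
      hence "(1 - fps_X ^ Suc k :: rat fps) $ 0 = 0" by simp
      thus False by simp
    qed
    ultimately show ?thesis
      unfolding fac_def by (metis dvd_triv_left dvd_div_mult_self)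
  qed
  have prods: "(\<Prod>k<n. fac k) * (\<Prod>k=1..n. 1 - fps_X ^ k) = (\<Prod>k=1..n. 1 - fps_X ^ (m * k))" for n
  proof -
    have "(\<Prod>k=1..n. f k) = (\<Prod>k<n. f (Suc k))" for f :: "nat \<Rightarrow> rat fps"
      by (induction n) simp_all
    thus ?thesis by (simp only: fac flip: prod.distrib)
  qed
  have "D * E = E oo fps_X ^ m"
  proof (rule fps_eq_if_X_power_dvd)
    fix i
    have "\<forall>\<^sub>F n in sequentially. \<forall>j\<in>{..i}. (\<Prod>k<n. fac k) $ j = D $ j"
      using ev by (intro eventually_ball_finite) auto
    hence "\<forall>\<^sub>F n in sequentially. (\<forall>j\<in>{..i}. (\<Prod>k<n. fac k) $ j = D $ j) \<and> n \<ge> i"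
      using eventually_ge_at_top eventually_conj by blast
    then obtain n where n: "n \<ge> i" "\<forall>j\<in>{..i}. (\<Prod>k<n. fac k) $ j = D $ j"
      by (auto dest: eventually_happens)
    have "fps_X ^ Suc i dvd (fps_X ^ Suc n :: rat fps)" using n by (intro le_imp_power_dvd) simp
    hence le: "fps_X ^ Suc n dvd f \<Longrightarrow> fps_X ^ Suc i dvd f" for f :: "rat fps"
      by (rule dvd_trans)
    have "fps_X ^ Suc i dvd D - (\<Prod>k<n. fac k)"
      unfolding fps_X_power_dvd_iff using n(2) by auto
    moreover have "fps_X ^ Suc i dvd E - (\<Prod>k=1..n. 1 - fps_X ^ k)"
      using euler_compose_cong[of 1 n, where 'a = rat] by (intro le) (simp add: E_def)
    ultimately have 1: "fps_X ^ Suc i dvd D * E - (\<Prod>k<n. fac k) * (\<Prod>k=1..n. 1 - fps_X ^ k)"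
      by (rule dvd_diff_mult)
    have 2: "fps_X ^ Suc i dvd (E oo fps_X ^ m) - (\<Prod>k=1..n. 1 - fps_X ^ (m * k))"
      using euler_compose_cong[of m n, where 'a = rat] assms by (intro le) (simp add: E_def)
    show "fps_X ^ Suc i dvd D * E - (E oo fps_X ^ m)"
      using dvd_diff[OF 1 2] by (simp only: prods diff_diff_eq2 diff_add_cancel)
  qed
  thus ?thesis
    unfolding D_def E_def of_int_fps_mult[symmetric] of_int_fps_compose_X_power[symmetric] of_int_fps_eq_iff .
qed

text \<open>Modulo \<open>p\<close> the generating function is \<open>euler ^ m\<close> divided by
  \<open>euler\<close>. The index on the right comes from the factor X and the substitution X^24 in
  \<open>theta_eq_euler\<close>.\<close>

lemma d_coeff_cong_theta:
  assumes "prime p" "m = p ^ t"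
  shows "int p dvd d_coeff m n - (theta ^ (m - 1)) $ (24 * n + (m - 1))"
proof -
  define D where "D = Abs_fps (d_coeff m)"
  have m: "m \<ge> 1" using assms by (simp add: prime_gt_0_nat Suc_leI)
  obtain k where k: "k * euler = 1" using euler_unit by blast
  have "of_nat p dvd D * euler - euler ^ m"
    using euler_prime_power_cong[OF assms(1), of t]
    by (simp only: D_def d_coeff_mult_euler[OF m] assms(2)[symmetric])
  hence "of_nat p dvd k * (D * euler - euler ^ m)" by simp
  also have "k * (D * euler - euler ^ m) = (k * euler) * (D - euler ^ (m - 1))"
  proof -
    have "euler ^ m = euler * euler ^ (m - 1)" using m by (simp flip: power_Suc)
    thus ?thesis by (simp add: algebra_simps)
  qed
  finally have "of_nat p dvd D - euler ^ (m - 1)" by (simp add: k)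
  moreover have "(theta ^ (m - 1)) $ (24 * n + (m - 1)) = (euler ^ (m - 1)) $ n"
  proof -
    have "theta ^ (m - 1) = fps_X ^ (m - 1) * (euler ^ (m - 1) oo fps_X ^ 24)"
      by (simp add: theta_eq_euler power_mult_distrib fps_compose_power)
    thus ?thesis by (simp add: fps_X_power_mult_nth fps_nth_compose_X_power)
  qed
  ultimately show ?thesis by (simp add: of_nat_dvd_int_fps_iff D_def)
qed

text \<open>As 5^(t + 1) - 1 = 4 + 5 (5^t - 1), the power is congruent modulo 5 to one treated in
  \<open>theta_power_4_mult_vanishing\<close>, because \<open>theta ^ 5\<close> is congruent to
  \<open>theta oo fps_X ^ 5\<close>.\<close>

lemma theta_power_5_vanishing:
  "5 dvd (theta ^ (5 ^ Suc t - 1)) $ (5 * j)"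
proof -
  have five: "prime (5::nat)" by simp
  have "theta ^ 5 = fps_X ^ 5 * (euler ^ 5 oo fps_X ^ 24)"
    by (simp add: theta_eq_euler power_mult_distrib fps_compose_power)
  moreover have "theta oo fps_X ^ 5 = fps_X ^ 5 * ((euler oo fps_X ^ 5) oo fps_X ^ 24)"
    by (simp add: theta_eq_euler fps_compose_mult_distrib fps_compose_assoc[symmetric] fps_X_power_compose
        flip: power_mult)
  moreover have "of_nat 5 dvd fps_X ^ 5 * (((euler oo fps_X ^ 5) - euler ^ 5) oo fps_X ^ 24)"
    by (intro dvd_mult of_nat_dvd_compose_X_power euler_prime_cong five)
  ultimately have cong: "of_nat 5 dvd (theta oo fps_X ^ 5) - theta ^ 5"
    by (simp only: fps_compose_sub_distrib right_diff_distrib)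
  define w :: nat where "w = 5 ^ t - 1"
  have "(5::nat) ^ Suc t - 1 = 4 + 5 * w"
  proof -
    obtain c where "(5::nat) ^ t = Suc c" by (metis not0_implies_Suc power_not_zero zero_neq_numeral)
    thus ?thesis unfolding w_def by simp
  qed
  hence "theta ^ (5 ^ Suc t - 1) = theta ^ 4 * (theta ^ 5) ^ w"
    by (simp only: power_add power_mult)
  moreover have "of_nat 5 dvd theta ^ 4 * (theta oo fps_X ^ 5) ^ w - theta ^ 4 * (theta ^ 5) ^ w"
    unfolding right_diff_distrib[symmetric] by (intro dvd_mult dvd_diff_power cong)
  ultimately have "int 5 dvd (theta ^ 4 * (theta oo fps_X ^ 5) ^ w - theta ^ (5 ^ Suc t - 1)) $ (5 * j)"
    unfolding of_nat_dvd_int_fps_iff by simp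
  thus ?thesis using theta_power_4_mult_vanishing[of w j] by (simp add: dvd_diff_right_iff)
qed

lemma d_coeff_progression:
  assumes "prime p" "t \<ge> 1" "m = p ^ t"
  shows "\<exists>A B. A \<ge> 1 \<and> (\<forall>n. int p dvd d_coeff m (A * n + B))"
proof -
  define r where "r = m - 1"
  have "m \<ge> 2"
    using assms prime_ge_2_nat[of p] self_le_power[of p t] by simp
  hence r: "r \<ge> 1" by (simp add: r_def)
  have "\<exists>k. \<forall>j. \<not> 5 dvd j \<longrightarrow> int p dvd (theta ^ r) $ (5 ^ k * j)"
  proof (cases "p = 5")
    case True
    obtain s where "t = Suc s" using assms(2) by (cases t) auto
    thus ?thesis
      using theta_power_5_vanishing[of s] assms(3) True by (intro exI[of _ 1]) (simp add: r_def)
  qed (use theta_power_vanishing[OF assms(1) _ r] in blast)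
  then obtain k where k: "\<And>j. \<not> 5 dvd j \<Longrightarrow> int p dvd (theta ^ r) $ (5 ^ k * j)" by blast
  have "coprime (24 :: nat) (5 ^ Suc k)"
  proof (rule coprime_power_right_iff[THEN iffD2], rule disjI1)
    show "coprime (24 :: nat) 5" by code_simp
  qed
  moreover have "(5::nat) ^ Suc k \<noteq> 1" by simp
  ultimately obtain x y :: nat where xy: "24 * x = 5 ^ Suc k * y + 1"
    using coprime_bezout_strong by blast
  \<comment> \<open>\<open>z\<close> is 5^k - r modulo 5^(k + 1), kept nonnegative, and
    \<open>x\<close> inverts 24. So 24 (x z) + r is 5^k modulo 5^(k + 1), that is, 5^k times a
    number prime to 5.\<close>
  define z where "z = 5 ^ k + r * (5 ^ Suc k - 1)"
  have z: "z + r = 5 ^ k * (1 + 5 * r)"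
  proof -
    have "(5::nat) ^ Suc k \<ge> 1" by simp
    then obtain c where c: "(5::nat) ^ Suc k = Suc c" by (metis Suc_pred' less_le_trans zero_less_one)
    have "z + r = 5 ^ k + r * 5 ^ Suc k" unfolding z_def c by simp
    thus ?thesis by (simp add: algebra_simps)
  qed
  have "int p dvd d_coeff m (5 ^ Suc k * n + x * z)" for n
  proof -
    have "24 * (5 ^ Suc k * n + x * z) + r = 24 * 5 ^ Suc k * n + (24 * x) * z + r"
      by (simp add: algebra_simps)
    also have "\<dots> = 24 * 5 ^ Suc k * n + 5 ^ Suc k * y * z + (z + r)"
      unfolding xy by (simp add: algebra_simps)
    also have "\<dots> = 5 ^ k * (1 + 5 * (r + y * z + 24 * n))"
      unfolding z by (simp add: algebra_simps)
    finally have e: "24 * (5 ^ Suc k * n + x * z) + r = 5 ^ k * (1 + 5 * (r + y * z + 24 * n))" .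
    have "\<not> 5 dvd 1 + 5 * (r + y * z + 24 * n)" by presburger
    hence "int p dvd (theta ^ r) $ (24 * (5 ^ Suc k * n + x * z) + r)"
      unfolding e by (rule k)
    thus ?thesis
      using d_coeff_cong_theta[OF assms(1,3), of "5 ^ Suc k * n + x * z"] unfolding r_def[symmetric]
      by (simp only: dvd_diff_left_iff)
  qed
  moreover have "(5::nat) ^ Suc k \<ge> 1" by simp
  ultimately show ?thesis by blast
qed

text \<open>The \<open>i\<close>-th progression consists of the numbers A q + B in which 2 divides q
  exactly \<open>i\<close> times. Already its first element is missing from the others.\<close>

lemma arith_prog_power_2_not_subset:
  assumes "A \<ge> 1" "i \<noteq> j"
  shows "\<not> arith_prog (A * 2 ^ Suc i) (A * 2 ^ i + B) \<subseteq> arith_prog (A * 2 ^ Suc j) (A * 2 ^ j + B)"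
proof
  assume "arith_prog (A * 2 ^ Suc i) (A * 2 ^ i + B) \<subseteq> arith_prog (A * 2 ^ Suc j) (A * 2 ^ j + B)"
  moreover have "A * 2 ^ Suc i * 0 + (A * 2 ^ i + B) \<in> arith_prog (A * 2 ^ Suc i) (A * 2 ^ i + B)"
    unfolding arith_prog_def by (rule rangeI)
  ultimately have "A * 2 ^ Suc i * 0 + (A * 2 ^ i + B) \<in> arith_prog (A * 2 ^ Suc j) (A * 2 ^ j + B)"
    by (rule subsetD)
  then obtain n where "A * 2 ^ Suc i * 0 + (A * 2 ^ i + B) = A * 2 ^ Suc j * n + (A * 2 ^ j + B)"
    unfolding arith_prog_def by blast
  hence "A * 2 ^ i = A * (2 ^ j * (2 * n + 1))" by (simp add: algebra_simps)
  hence eq: "2 ^ i = 2 ^ j * (2 * n + 1)" using assms(1) by simp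
  hence "2 ^ j \<le> (2::nat) ^ i" by simp
  hence "j \<le> i" by simp
  hence "j < i" using assms(2) by simp
  then obtain d where "i = j + Suc d" using less_imp_Suc_add by auto
  hence "2 ^ j * (2 * 2 ^ d) = 2 ^ j * (2 * n + 1)" using eq by (simp only: power_add power_Suc)
  hence "2 * 2 ^ d = 2 * n + 1" by (simp only: mult_cancel_left) simp
  thus False by presburger
qed

theorem theorem1p3:
  fixes p t m :: nat
  assumes "prime p" and "t \<ge> 1" and "m = p ^ t"
  shows "\<exists>F. infinite F \<and> non_nested F \<and>
    (\<forall>S\<in>F. \<exists>A B. A \<ge> 1 \<and> S = arith_prog A B \<and>
       (\<forall>n. [d_coeff m (A * n + B) = 0] (mod int p)))"
proof -
  obtain A B where A: "A \<ge> 1" and AB: "\<And>n. int p dvd d_coeff m (A * n + B)"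
    using d_coeff_progression[OF assms] by blast
  \<comment> \<open>A single good progression suffices: these parts of it are infinitely many and
    pairwise not nested.\<close>
  define S where "S i = arith_prog (A * 2 ^ Suc i) (A * 2 ^ i + B)" for i
  have not_subset: "\<not> S i \<subseteq> S j" if "i \<noteq> j" for i j
    unfolding S_def by (rule arith_prog_power_2_not_subset[OF A that])
  hence "inj S" by (intro injI) (metis order_refl)
  hence "infinite (range S)" by (rule range_inj_infinite)
  moreover have "non_nested (range S)"
    unfolding non_nested_def pairwise_image
    by (rule pairwiseI) (use not_subset in auto)
  moreover have "\<exists>A' B'. A' \<ge> 1 \<and> S i = arith_prog A' B' \<and> (\<forall>n. [d_coeff m (A' * n + B') = 0] (mod int p))" for i
  proof (rule exI[of _ "A * 2 ^ Suc i"], rule exI[of _ "A * 2 ^ i + B"], intro conjI allI)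
    fix n
    have "A * 2 ^ Suc i * n + (A * 2 ^ i + B) = A * (2 ^ Suc i * n + 2 ^ i) + B"
      by (simp add: algebra_simps)
    thus "[d_coeff m (A * 2 ^ Suc i * n + (A * 2 ^ i + B)) = 0] (mod int p)"
      using AB by (simp only: cong_0_iff)
  qed (use A in \<open>simp_all add: S_def\<close>)
  ultimately show ?thesis by (intro exI[of _ "range S"]) blast
qed

end
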